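(* Let $p,q$ be relatively prime positive integers, let $N=2(p+q)$, and let $\mathcal{C}_N(p)$ denote the class of non-singular periodic billiard trajectories in the unit square $\mathbf{T}=[0,1]\times[0,1]$ of period $N$ with $p$ bouncing points on the bottom edge and $q$ bouncing points on the left edge. For every $a\in(0,1)$ such that $\gamma=\gamma(a,\tfrac{p}{q})\in\mathcal{C}_N(p)$, $$\mathrm{r_{cov}}\left(\gamma(a,\tfrac{p}{q})\right)=\frac{1}{\sqrt{p^2+q^2}}\max\left(\{pa\},\,1-\{pa\}\right).$$ Moreover, in the class $\mathcal{C}_N(p)$ the covering radius is minimized when $a\in\left\{\frac{1}{2p},\frac{3}{2p},\ldots,\frac{2p-1}{2p}\right\}$, giving $$\min_{\gamma\in\mathcal{C}_N(p)}\mathrm{r_{cov}}(\gamma)=\frac{1}{2\sqrt{p^2+q^2}}.$$ These radius-minimizing trajectories correspond to those starting at the midpoint of each of the subintervals $\left[\frac{i}{p},\frac{i+1}{p}\right]\times\{0\}$ ($0\le i\le p-1$) of the bottom edge.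
   Context: A (billiard) trajectory in the unit square $\mathbf{T}=[0,1]\times[0,1]\subset\mathbb{R}^2$ is a sequence of directed straight segments in $\mathbf{T}$, each beginning where the previous one ended, with angle of incidence equal to angle of reflection at each bounce on a side; the trajectory terminates if it meets a corner. It is singular if it meets some corner of $\mathbf{T}$. A non-singular trajectory is periodic if it returns to its starting point with the same direction after finitely many bounces; periodic trajectories are taken to be primitive (traversed only once), and the period is the number of bounces before returning to the starting position, including the final one. The orbit of a trajectory $\gamma$ is the set of points of $\mathbf{T}$ lying on $\gamma$, and is also denoted $\gamma$; trajectories of period at least 4 are represented, up to having the same orbit, by trajectories of the form $\gamma(a,\frac pq)$ with $a\in(0,1)$ and $p,q$ relatively prime positive integers. For $a\in(0,1)$ and relatively prime positive integers $p,q$, $\gamma(a,\frac pq)$ is the trajectory starting at $(a,0)$ with initial angle $\arctan(\frac pq)$, measured counterclockwise from the positive $x$-axis. (It is singular exactly when $a\in\{\frac1p,\ldots,\frac{p-1}{p}\}$, and periodic otherwise.) For a trajectory $\gamma$, $N_r(\gamma)$ is the open $r$-neighborhood of its orbit in $\mathbb{R}^2$, and the optimal covering radius is $\mathrm{r_{cov}}(\gamma)=\inf\{r>0: N_r(\gamma)\supset\mathbf{T}\}$. For real $t$, $\{t\}=t-\lfloor t\rfloor$. *)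

theory Defs
  imports "HOL-Analysis.Analysis"
begin

type_synonym point = "real \<times> real"

definition table :: "point set" where
  "table = {0..1} \<times> {0..1}"

definition corners :: "point set" where
  "corners = {0, 1} \<times> {0, 1}"

definition bottom_edge :: "point set" where
  "bottom_edge = {0..1} \<times> {0}"

definition left_edge :: "point set" where
  "left_edge = {0} \<times> {0..1}"

definition exit_point :: "point \<Rightarrow> point \<Rightarrow> point" where
  "exit_point x u = x + Sup {t. x + t *\<^sub>R u \<in> table} *\<^sub>R u"

text \<open>A directed segment is encoded by its starting point and its (unit) direction; it ends where
  the ray leaves the table.\<close>

type_synonym dsegment = "point \<times> point"

definition seg :: "dsegment \<Rightarrow> point set" where
  "seg s = closed_segment (fst s) (exit_point (fst s) (snd s))"

text \<open>Direction after a bounce at a point of a side other than a corner: the component normal to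
  the side changes sign and the tangential one is kept, so that the angle of incidence equals the
  angle of reflection.\<close>

definition reflect :: "point \<Rightarrow> point \<Rightarrow> point" where
  "reflect x u = (if fst x \<in> {0, 1} then - fst u else fst u,
                  if snd x \<in> {0, 1} then - snd u else snd u)"

definition bounce :: "dsegment \<Rightarrow> dsegment option" where
  "bounce s = (let y = exit_point (fst s) (snd s)
               in if y \<in> corners then None else Some (y, reflect y (snd s)))"

text \<open>The value at \<open>k\<close> is the segment following the \<open>k\<close>-th bounce, or \<open>None\<close> if the trajectory has
  terminated in a corner before.\<close>

type_synonym trajectory = "nat \<Rightarrow> dsegment option"

primrec traj_from :: "dsegment \<Rightarrow> trajectory" where
  "traj_from s 0 = Some s"
| "traj_from s (Suc k) = Option.bind (traj_from s k) bounce"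

text \<open>Starting points may be anywhere in the table, also in its interior; the last condition excludes
  directions that point out of the table.\<close>

definition trajectories :: "trajectory set" where
  "trajectories = {traj_from (x, u) | x u. x \<in> table \<and> norm u = 1 \<and> exit_point x u \<noteq> x}"

definition orbit :: "trajectory \<Rightarrow> point set" where
  "orbit \<gamma> = (\<Union>s\<in>{s. \<exists>k. \<gamma> k = Some s}. seg s)"

definition singular :: "trajectory \<Rightarrow> bool" where
  "singular \<gamma> \<longleftrightarrow> orbit \<gamma> \<inter> corners \<noteq> {}"

text \<open>After \<open>n\<close> bounces the trajectory passes its starting point in its initial direction. If it
  starts on a side, the starting point can only be the first point of the \<open>n\<close>-th segment, so the
  bounce there is included in \<open>n\<close>.\<close>

definition returns_after :: "trajectory \<Rightarrow> nat \<Rightarrow> bool" where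
  "returns_after \<gamma> n \<longleftrightarrow>
     (\<exists>x u y. \<gamma> 0 = Some (x, u) \<and> \<gamma> n = Some (y, u) \<and> x \<in> seg (y, u))"

definition periodic :: "trajectory \<Rightarrow> bool" where
  "periodic \<gamma> \<longleftrightarrow> \<not> singular \<gamma> \<and> (\<exists>n>0. returns_after \<gamma> n)"

definition period :: "trajectory \<Rightarrow> nat" where
  "period \<gamma> = (LEAST n. n > 0 \<and> returns_after \<gamma> n)"

definition bounce_points :: "trajectory \<Rightarrow> point set" where
  "bounce_points \<gamma> = {x. \<exists>k>0. \<exists>u. \<gamma> k = Some (x, u)}"

definition traj_class :: "nat \<Rightarrow> nat \<Rightarrow> nat \<Rightarrow> trajectory set" where
  "traj_class N p q =
     {\<gamma> \<in> trajectories. periodic \<gamma> \<and> period \<gamma> = N \<and>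
        card (bounce_points \<gamma> \<inter> bottom_edge) = p \<and>
        card (bounce_points \<gamma> \<inter> left_edge) = q}"

definition billiard :: "real \<Rightarrow> real \<Rightarrow> trajectory" where
  "billiard a m = traj_from ((a, 0), (cos (arctan m), sin (arctan m)))"

definition nbhd :: "real \<Rightarrow> trajectory \<Rightarrow> point set" where
  "nbhd r \<gamma> = (\<Union>x\<in>orbit \<gamma>. ball x r)"

definition rcov :: "trajectory \<Rightarrow> real" where
  "rcov \<gamma> = Inf {r. r > 0 \<and> table \<subseteq> nbhd r \<gamma>}"

end

theory Submission
  imports Defs
begin

text \<open>Reflecting the table in its sides unfolds a trajectory with slope \<open>p / q\<close> to a line
  \<open>p x - q y = c\<close>, which the map taking each coordinate to its distance from the even integers
  folds back onto the orbit. As \<open>p\<close> and \<open>q\<close> are coprime, the full preimage of the orbit contains every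
  line \<open>p x - q y = e\<close> with \<open>e\<close> congruent to \<open>c\<close> or \<open>-c\<close> modulo 2; so half the widest gap
  between neighbouring lines bounds the covering radius, folding being a contraction. A corner of the
  table lies in the middle of such gaps of both slopes, so the bound is attained. A trajectory is
  singular iff \<open>c\<close> is an integer, and otherwise it meets the bottom \<open>p\<close> times and the left edge \<open>q\<close>
  times before it closes up, so that these two counts determine its slope.\<close>

subsection \<open>Folding\<close>

text \<open>The levels \<open>e\<close> congruent to \<open>c\<close> or \<open>- c\<close> modulo 2
  surround each even integer at distance \<open>tent c\<close> and each odd integer at distance
  \<open>1 - tent c\<close>. Lines whose levels differ by \<open>h\<close> lie
  \<open>h / sqrt (p\<^sup>2 + q\<^sup>2)\<close> apart, which is the origin of both the maximum and
  the square root. The middles of the gaps are the integer levels, and lattice points, which fold to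
  corners, have integer level; as \<open>p\<close> and \<open>q\<close> are not both even, the
  corners of the table realise both parities. Lines of slope \<open>- p / q\<close> in the preimage
  cross every gap, so the lower bound cannot be read off from two neighbouring lines; at corners it
  follows from subadditivity of \<open>tent\<close> and Cauchy-Schwarz. The obstacle is that
  trajectories are given segment by segment through a supremum, and that members of the class may
  start anywhere and in any direction. Hence the exact correspondence between bounces and grid
  crossings of the unfolded line, and the separate exclusion of directions parallel to an
  edge.\<close>

definition tent :: "real \<Rightarrow> real" where
  "tent x = (if even \<lfloor>x\<rfloor> then frac x else 1 - frac x)"

text \<open>The slope of \<open>tent\<close> immediately to the right of \<open>x\<close>. At an
  integer, \<open>floor\<close> selects the cell about to be entered, so this is the direction after
  the bounce.\<close>

definition dir :: "real \<Rightarrow> real" where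
  "dir x = (if even \<lfloor>x\<rfloor> then 1 else - 1)"

lemma tent_bounds: "0 \<le> tent x" "tent x \<le> 1"
  by (auto simp: tent_def frac_ge_0 less_imp_le[OF frac_lt_1])

lemma tent_cases: obtains k :: int where "x = 2 * of_int k + tent x" | k :: int where "x = 2 * of_int k - tent x"
proof (cases "even \<lfloor>x\<rfloor>")
  case True
  then obtain k where "\<lfloor>x\<rfloor> = 2 * k" by blast
  then have "x = 2 * of_int k + tent x" by (simp add: tent_def frac_def)
  then show ?thesis by (rule that)
next
  case False
  then obtain k where "\<lfloor>x\<rfloor> = 2 * k + 1" by (elim oddE)
  then have "x = 2 * of_int (k + 1) - tent x" by (simp add: tent_def frac_def)
  then show ?thesis by (rule that)
qed

lemma tent_nearest: obtains k :: int where "tent x = \<bar>x - 2 * of_int k\<bar>"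
proof -
  obtain k :: int where "x = 2 * of_int k + tent x \<or> x = 2 * of_int k - tent x"
    by (metis tent_cases)
  then have "tent x = \<bar>x - 2 * of_int k\<bar>" using tent_bounds(1)[of x] by linarith
  then show ?thesis by (rule that)
qed

lemma tent_eqI:
  assumes "\<bar>x - 2 * of_int k\<bar> \<le> 1"
  shows "tent x = \<bar>x - 2 * of_int k\<bar>"
proof -
  have "\<lfloor>x\<rfloor> = 2 * k - 1 \<or> \<lfloor>x\<rfloor> = 2 * k \<or> (x = 2 * of_int k + 1 \<and> \<lfloor>x\<rfloor> = 2 * k + 1)"
    using assms by linarith
  then show ?thesis
  proof (elim disjE)
    assume "\<lfloor>x\<rfloor> = 2 * k - 1"
    moreover from this have "x < 2 * of_int k" by linarith
    ultimately show ?thesis by (simp add: tent_def frac_def)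
  next
    assume "\<lfloor>x\<rfloor> = 2 * k"
    moreover from this have "x \<ge> 2 * of_int k" by linarith
    ultimately show ?thesis by (simp add: tent_def frac_def)
  next
    assume *: "x = 2 * of_int k + 1 \<and> \<lfloor>x\<rfloor> = 2 * k + 1"
    have "odd \<lfloor>x\<rfloor>" unfolding conjunct2[OF *] by simp
    moreover from * have "frac x = 0" unfolding frac_def by linarith
    ultimately show ?thesis using * by (simp add: tent_def)
  qed
qed

text \<open>With \<open>tent_nearest\<close> this characterises \<open>tent\<close> as the distance
  to the even integers; the Lipschitz bound and subadditivity both come from this pair.\<close>

lemma tent_le: "tent x \<le> \<bar>x - 2 * of_int k\<bar>"
proof (cases "\<bar>x - 2 * of_int k\<bar> \<le> 1")
  case True
  then show ?thesis by (simp add: tent_eqI)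
next
  case False
  then show ?thesis using tent_bounds(2)[of x] by linarith
qed

text \<open>The fibres of \<open>tent\<close> are the orbits of the group generated by negation and
  translation by 2, the unfolding group of one coordinate.\<close>

lemma tent_eq_iff: "tent x = tent y \<longleftrightarrow> (\<exists>k::int. x = 2 * of_int k + y \<or> x = 2 * of_int k - y)"
proof
  assume *: "tent x = tent y"
  consider k l :: int where "x = 2 * of_int k + tent x" "y = 2 * of_int l + tent y"
    | k l :: int where "x = 2 * of_int k + tent x" "y = 2 * of_int l - tent y"
    | k l :: int where "x = 2 * of_int k - tent x" "y = 2 * of_int l + tent y"
    | k l :: int where "x = 2 * of_int k - tent x" "y = 2 * of_int l - tent y"
    by (metis tent_cases)
  then show "\<exists>k::int. x = 2 * of_int k + y \<or> x = 2 * of_int k - y"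
  proof cases
    case 1 then show ?thesis using * by (intro exI[of _ "k - l"]) auto
  next
    case 2 then show ?thesis using * by (intro exI[of _ "k + l"]) auto
  next
    case 3 then show ?thesis using * by (intro exI[of _ "k + l"]) auto
  next
    case 4 then show ?thesis using * by (intro exI[of _ "k - l"]) auto
  qed
next
  assume "\<exists>k::int. x = 2 * of_int k + y \<or> x = 2 * of_int k - y"
  then obtain k :: int where k: "x = 2 * of_int k + y \<or> x = 2 * of_int k - y" by blast
  obtain l where l: "tent y = \<bar>y - 2 * of_int l\<bar>" by (rule tent_nearest)
  \<comment> \<open>The symmetry that carries \<open>y\<close> to \<open>x\<close> also carries an
    even integer nearest to \<open>y\<close> to one nearest to \<open>x\<close>.\<close>
  define m where "m = (if x = 2 * of_int k + y then k + l else k - l)"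
  have "\<bar>x - 2 * of_int m\<bar> = tent y"
    using k unfolding m_def l by (auto simp: algebra_simps abs_if)
  then show "tent x = tent y"
    using tent_eqI[of x m] tent_bounds[of y] by simp
qed

lemma tent_add_even [simp]: "tent (x + 2 * of_int k) = tent x"
  unfolding tent_eq_iff by (auto intro: exI[of _ k])

lemma tent_minus [simp]: "tent (- x) = tent x"
  unfolding tent_eq_iff by (auto intro: exI[of _ 0])

lemma tent_idem: "0 \<le> x \<Longrightarrow> x \<le> 1 \<Longrightarrow> tent x = x"
  using tent_eqI[of x 0] by simp

lemma tent_add_one: "tent (x + 1) = 1 - tent x"
  by (auto simp: tent_def frac_def)

lemma tent_eq_0_iff: "tent x = 0 \<longleftrightarrow> (\<exists>k::int. x = 2 * of_int k)"
  using tent_eq_iff[of x 0] tent_idem[of 0] by simp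

lemma tent_int_iff: "tent x \<in> {0, 1} \<longleftrightarrow> x \<in> \<int>"
proof
  assume "tent x \<in> {0, 1}"
  then have "frac x \<in> {0, 1}"
    by (auto simp: tent_def split: if_splits)
  then have "frac x = 0" using frac_lt_1[of x] by auto
  then show "x \<in> \<int>" by simp
next
  assume "x \<in> \<int>"
  then have "frac x = 0" by simp
  then show "tent x \<in> {0, 1}" by (simp add: tent_def)
qed

lemma tent_lipschitz: "\<bar>tent x - tent y\<bar> \<le> \<bar>x - y\<bar>"
proof -
  have *: "tent x - tent y \<le> \<bar>x - y\<bar>" for x y
  proof -
    obtain k where "tent y = \<bar>y - 2 * of_int k\<bar>" by (rule tent_nearest)
    then show ?thesis using tent_le[of x k] by linarith
  qed
  show ?thesis using *[of x y] *[of y x] by linarith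
qed

lemma tent_linear:
  fixes x y :: real
  assumes "x \<le> y" "y \<le> of_int \<lfloor>x\<rfloor> + 1"
  shows "tent y = tent x + (y - x) * dir x"
proof (cases "y = of_int \<lfloor>x\<rfloor> + 1")
  case True
  then have "frac y = 0" "\<lfloor>y\<rfloor> = \<lfloor>x\<rfloor> + 1" by auto
  then show ?thesis using True by (simp add: tent_def dir_def frac_def)
next
  case False
  then have "\<lfloor>y\<rfloor> = \<lfloor>x\<rfloor>" using assms by linarith
  then show ?thesis by (simp add: tent_def dir_def frac_def)
qed

text \<open>The law of reflection in one coordinate. The inequality \<open>x < y\<close> is strict
  because at a start on a wall \<open>dir x\<close> already belongs to the cell ahead and must not
  be flipped again.\<close>

lemma dir_reflect:
  fixes x y :: real
  assumes "x < y" "y \<le> of_int \<lfloor>x\<rfloor> + 1"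
  shows "dir y = (if tent y \<in> {0, 1} then - dir x else dir x)"
proof (cases "y = of_int \<lfloor>x\<rfloor> + 1")
  case True
  then have "frac y = 0" "\<lfloor>y\<rfloor> = \<lfloor>x\<rfloor> + 1" by auto
  then show ?thesis by (simp add: dir_def tent_def)
next
  case False
  then have f: "\<lfloor>y\<rfloor> = \<lfloor>x\<rfloor>" using assms by linarith
  then have "y \<notin> \<int>" using assms(1)
    by (metis Ints_cases floor_of_int linorder_not_less of_int_floor_le)
  then show ?thesis using f by (simp only: tent_int_iff) (simp add: dir_def)
qed

text \<open>Equal directions put both cells at the same parity, which leaves only the translations
  among the symmetries of \<open>tent\<close>. The relation between the floors is kept because
  floors count bounces.\<close>

lemma tent_return:
  fixes x x' y :: real
  assumes "x' \<le> y" "y \<le> of_int \<lfloor>x'\<rfloor> + 1" "tent y = tent x" "dir x' = dir x"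
  obtains i :: int where "y = x + 2 * of_int i" "\<lfloor>x'\<rfloor> = \<lfloor>x\<rfloor> + 2 * i"
proof -
  have par: "even \<lfloor>x'\<rfloor> \<longleftrightarrow> even \<lfloor>x\<rfloor>"
    using assms(4) by (auto simp: dir_def split: if_splits)
  then have "even (\<lfloor>x'\<rfloor> - \<lfloor>x\<rfloor>)" by simp
  then obtain i where i: "\<lfloor>x'\<rfloor> - \<lfloor>x\<rfloor> = 2 * i" by blast
  have "tent y = tent x' + (y - x') * dir x'"
    using assms by (intro tent_linear)
  then have "frac x' + (y - x') = frac x"
    using assms(3) par by (auto simp: tent_def dir_def split: if_splits)
  then have "y = x + (\<lfloor>x'\<rfloor> - \<lfloor>x\<rfloor>)" by (simp add: frac_def)
  then show ?thesis using i by (intro that[of i]) linarith+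
qed

lemma dir_add_even [simp]: "dir (x + 2 * of_int k) = dir x"
proof -
  have "\<lfloor>x + 2 * of_int k\<rfloor> = \<lfloor>x\<rfloor> + 2 * k" by linarith
  then show ?thesis by (simp add: dir_def)
qed

definition fold_pt :: "point \<Rightarrow> point" where
  "fold_pt z = (tent (fst z), tent (snd z))"

lemma fold_pt_in_table: "fold_pt z \<in> table"
  by (simp add: fold_pt_def table_def tent_bounds)

lemma fold_pt_corner_iff: "fold_pt z \<in> corners \<longleftrightarrow> fst z \<in> \<int> \<and> snd z \<in> \<int>"
  unfolding corners_def fold_pt_def mem_Times_iff fst_conv snd_conv tent_int_iff ..

lemma fold_pt_table: "z \<in> table \<Longrightarrow> fold_pt z = z"
  by (cases z) (auto simp: table_def fold_pt_def tent_idem)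

lemma dist_fold_pt: "dist (fold_pt z) (fold_pt w) \<le> dist z w"
  unfolding dist_prod_def fold_pt_def fst_conv snd_conv dist_real_def
  by (intro real_sqrt_le_mono add_mono power_mono tent_lipschitz) auto

subsection \<open>The unfolded flow\<close>

text \<open>The unfolded direction always has positive components: the signs of the actual direction are
  encoded in the cell of the unfolded position.\<close>

locale flow =
  fixes v :: point
  assumes pos: "0 < fst v" "0 < snd v"
begin

text \<open>The time to the next grid line of either family. A point on a grid line belongs to the
  cell ahead of it, so this time is never zero.\<close>

definition hit :: "point \<Rightarrow> real" where
  "hit X = min ((of_int \<lfloor>fst X\<rfloor> + 1 - fst X) / fst v) ((of_int \<lfloor>snd X\<rfloor> + 1 - snd X) / snd v)"

definition nxt :: "point \<Rightarrow> point" where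
  "nxt X = X + hit X *\<^sub>R v"

definition heading :: "point \<Rightarrow> point" where
  "heading X = (dir (fst X) * fst v, dir (snd X) * snd v)"

text \<open>A crossing counter: away from corners each bounce raises it by one. It converts
  positions on the unfolded line into bounce numbers and serves as a termination measure.\<close>

definition cells :: "point \<Rightarrow> int" where
  "cells X = \<lfloor>fst X\<rfloor> + \<lfloor>snd X\<rfloor>"

abbreviation traj :: "point \<Rightarrow> trajectory" where
  "traj X \<equiv> traj_from (fold_pt X, heading X)"

lemma hit_pos: "0 < hit X"
proof -
  have "0 < of_int \<lfloor>x\<rfloor> + 1 - x" for x :: real by linarith
  then show ?thesis using pos by (simp add: hit_def)
qed

lemma le_hit_iff:
  "t \<le> hit X \<longleftrightarrow> fst X + t * fst v \<le> of_int \<lfloor>fst X\<rfloor> + 1 \<and> snd X + t * snd v \<le> of_int \<lfloor>snd X\<rfloor> + 1"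
  using pos by (simp add: hit_def pos_le_divide_eq algebra_simps)

lemma less_hit_iff:
  "t < hit X \<longleftrightarrow> fst X + t * fst v < of_int \<lfloor>fst X\<rfloor> + 1 \<and> snd X + t * snd v < of_int \<lfloor>snd X\<rfloor> + 1"
  using pos by (simp add: hit_def pos_less_divide_eq algebra_simps)

lemma floor_flow:
  assumes "0 \<le> t" "t < hit X"
  shows "\<lfloor>fst (X + t *\<^sub>R v)\<rfloor> = \<lfloor>fst X\<rfloor>" "\<lfloor>snd (X + t *\<^sub>R v)\<rfloor> = \<lfloor>snd X\<rfloor>"
proof -
  have "0 \<le> t * fst v" "0 \<le> t * snd v" using assms pos by auto
  then show "\<lfloor>fst (X + t *\<^sub>R v)\<rfloor> = \<lfloor>fst X\<rfloor>" "\<lfloor>snd (X + t *\<^sub>R v)\<rfloor> = \<lfloor>snd X\<rfloor>"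
    using assms(2) unfolding less_hit_iff by (auto simp: floor_eq_iff) linarith+
qed

lemma cells_mono: "0 \<le> t \<Longrightarrow> cells X \<le> cells (X + t *\<^sub>R v)"
  unfolding cells_def using pos by (intro add_mono floor_mono) auto

lemma fold_pt_flow:
  assumes "0 \<le> t" "t \<le> hit X"
  shows "fold_pt (X + t *\<^sub>R v) = fold_pt X + t *\<^sub>R heading X"
proof -
  have "0 \<le> t * fst v" "0 \<le> t * snd v" using assms pos by auto
  then show ?thesis
    using assms(2) tent_linear[of "fst X" "fst X + t * fst v"] tent_linear[of "snd X" "snd X + t * snd v"]
    unfolding le_hit_iff by (simp add: fold_pt_def heading_def algebra_simps)
qed

lemma exit_time_le:
  assumes "fold_pt X + t *\<^sub>R heading X \<in> table"
  shows "t \<le> hit X"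
proof -
  have *: "x + t * w \<le> of_int \<lfloor>x\<rfloor> + 1" if "tent x + t * (dir x * w) \<in> {0..1}" for x w
    using that by (auto simp: tent_def dir_def frac_def split: if_splits)
  show ?thesis
    using assms unfolding le_hit_iff
    by (auto simp: table_def fold_pt_def heading_def intro!: *)
qed

text \<open>The supremum is a maximum: folding is affine until time \<open>hit X\<close>, and every
  time at which the straight continuation lies in the table is at most \<open>hit X\<close>.\<close>

lemma exit_point_heading: "exit_point (fold_pt X) (heading X) = fold_pt (nxt X)"
proof -
  have "Sup {t. fold_pt X + t *\<^sub>R heading X \<in> table} = hit X"
  proof (rule cSup_eq_maximum)
    show "hit X \<in> {t. fold_pt X + t *\<^sub>R heading X \<in> table}"
      using fold_pt_flow[of "hit X" X] hit_pos[of X] fold_pt_in_table[of "X + hit X *\<^sub>R v"] by simp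
  qed (auto intro: exit_time_le)
  then show ?thesis
    using fold_pt_flow[of "hit X" X] hit_pos[of X] by (simp add: exit_point_def nxt_def)
qed

lemma seg_heading: "seg (fold_pt X, heading X) = {fold_pt (X + t *\<^sub>R v) | t. 0 \<le> t \<and> t \<le> hit X}"
proof -
  have end_pt: "exit_point (fold_pt X) (heading X) = fold_pt X + hit X *\<^sub>R heading X"
    using fold_pt_flow[of "hit X" X] hit_pos[of X] by (simp add: exit_point_heading nxt_def)
  have "closed_segment (fold_pt X) (fold_pt X + hit X *\<^sub>R heading X)
      = {fold_pt X + t *\<^sub>R heading X | t. 0 \<le> t \<and> t \<le> hit X}" (is "?S = ?T")
  proof
    show "?S \<subseteq> ?T"
    proof
      fix y assume "y \<in> ?S"
      then obtain u where "0 \<le> u" "u \<le> 1"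
        "y = (1 - u) *\<^sub>R fold_pt X + u *\<^sub>R (fold_pt X + hit X *\<^sub>R heading X)"
        unfolding in_segment by blast
      then show "y \<in> ?T" using hit_pos[of X]
        by (intro CollectI exI[of _ "u * hit X"]) (auto simp: algebra_simps mult_left_le_one_le)
    qed
    show "?T \<subseteq> ?S"
    proof
      fix y assume "y \<in> ?T"
      then obtain t where "0 \<le> t" "t \<le> hit X" "y = fold_pt X + t *\<^sub>R heading X" by blast
      then show "y \<in> ?S" using hit_pos[of X]
        unfolding in_segment by (intro exI[of _ "t / hit X"]) (auto simp: algebra_simps)
    qed
  qed
  also have "\<dots> = {fold_pt (X + t *\<^sub>R v) | t. 0 \<le> t \<and> t \<le> hit X}"
    using fold_pt_flow by (intro Collect_cong) metis
  finally show ?thesis by (simp add: seg_def end_pt)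
qed

lemma reflect_heading: "reflect (fold_pt (nxt X)) (heading X) = heading (nxt X)"
proof -
  have "fst X < fst (nxt X)" "snd X < snd (nxt X)"
    using pos hit_pos[of X] by (auto simp: nxt_def)
  moreover have "fst (nxt X) \<le> of_int \<lfloor>fst X\<rfloor> + 1" "snd (nxt X) \<le> of_int \<lfloor>snd X\<rfloor> + 1"
    using le_hit_iff[of "hit X" X] by (auto simp: nxt_def)
  ultimately show ?thesis
    using dir_reflect[of "fst X" "fst (nxt X)"] dir_reflect[of "snd X" "snd (nxt X)"]
    by (simp add: reflect_def heading_def fold_pt_def)
qed

lemma bounce_heading:
  "bounce (fold_pt X, heading X) =
     (if fold_pt (nxt X) \<in> corners then None else Some (fold_pt (nxt X), heading (nxt X)))"
  by (simp add: bounce_def exit_point_heading reflect_heading)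

text \<open>Away from a corner the end of a segment lies on a grid line of exactly one family, so
  exactly one of the two floors jumps.\<close>

lemma cells_nxt:
  assumes "fold_pt (nxt X) \<notin> corners"
  shows "cells (nxt X) = cells X + 1"
proof -
  have lt: "fst X < fst (nxt X)" "snd X < snd (nxt X)"
    using pos hit_pos[of X] by (auto simp: nxt_def)
  have le: "fst (nxt X) \<le> of_int \<lfloor>fst X\<rfloor> + 1" "snd (nxt X) \<le> of_int \<lfloor>snd X\<rfloor> + 1"
    using le_hit_iff[of "hit X" X] by (auto simp: nxt_def)
  have "\<not> (fst (nxt X) < of_int \<lfloor>fst X\<rfloor> + 1 \<and> snd (nxt X) < of_int \<lfloor>snd X\<rfloor> + 1)"
    using less_hit_iff[of "hit X" X] by (simp add: nxt_def)
  moreover have "\<not> (fst (nxt X) = of_int \<lfloor>fst X\<rfloor> + 1 \<and> snd (nxt X) = of_int \<lfloor>snd X\<rfloor> + 1)"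
    using assms unfolding fold_pt_corner_iff by (metis Ints_1 Ints_add Ints_of_int)
  ultimately consider "fst (nxt X) = of_int \<lfloor>fst X\<rfloor> + 1" "snd (nxt X) < of_int \<lfloor>snd X\<rfloor> + 1"
    | "fst (nxt X) < of_int \<lfloor>fst X\<rfloor> + 1" "snd (nxt X) = of_int \<lfloor>snd X\<rfloor> + 1"
    using le by linarith
  then have "\<lfloor>fst (nxt X)\<rfloor> + \<lfloor>snd (nxt X)\<rfloor> = \<lfloor>fst X\<rfloor> + \<lfloor>snd X\<rfloor> + 1"
  proof cases
    case 1
    then have "\<lfloor>fst (nxt X)\<rfloor> = \<lfloor>fst X\<rfloor> + 1" "\<lfloor>snd (nxt X)\<rfloor> = \<lfloor>snd X\<rfloor>"
      using lt by linarith+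
    then show ?thesis by simp
  next
    case 2
    then have "\<lfloor>fst (nxt X)\<rfloor> = \<lfloor>fst X\<rfloor>" "\<lfloor>snd (nxt X)\<rfloor> = \<lfloor>snd X\<rfloor> + 1"
      using lt by linarith+
    then show ?thesis by simp
  qed
  then show ?thesis by (simp add: cells_def)
qed

lemma iterate_flow:
  obtains t where "(nxt ^^ k) X = X + t *\<^sub>R v" "0 \<le> t" "0 < k \<Longrightarrow> 0 < t"
proof -
  have "\<exists>t. (nxt ^^ k) X = X + t *\<^sub>R v \<and> 0 \<le> t \<and> (0 < k \<longrightarrow> 0 < t)"
  proof (induction k)
    case (Suc k)
    then obtain t where t: "(nxt ^^ k) X = X + t *\<^sub>R v" "0 \<le> t" by blast
    then have "(nxt ^^ Suc k) X = X + (t + hit (X + t *\<^sub>R v)) *\<^sub>R v"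
      by (simp add: nxt_def[of "X + t *\<^sub>R v"] algebra_simps)
    then show ?case using t(2) hit_pos[of "X + t *\<^sub>R v"]
      by (intro exI[of _ "t + hit (X + t *\<^sub>R v)"]) auto
  qed (auto intro: exI[of _ 0])
  then show ?thesis using that by blast
qed

lemma cells_iterate:
  assumes "\<And>k. fold_pt ((nxt ^^ Suc k) X) \<notin> corners"
  shows "cells ((nxt ^^ k) X) = cells X + int k"
proof (induction k)
  case (Suc k)
  then show ?case using cells_nxt[of "(nxt ^^ k) X"] assms[of k] by simp
qed simp

lemma flow_cell:
  assumes "0 \<le> t" "\<And>k. fold_pt ((nxt ^^ Suc k) X) \<notin> corners"
  obtains k t' where "X + t *\<^sub>R v = (nxt ^^ k) X + t' *\<^sub>R v" "0 \<le> t'" "t' < hit ((nxt ^^ k) X)"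
proof -
  have "\<exists>k t'. X + t *\<^sub>R v = (nxt ^^ k) X + t' *\<^sub>R v \<and> 0 \<le> t' \<and> t' < hit ((nxt ^^ k) X)"
    using assms
  \<comment> \<open>No lower bound on the lengths of segments is at hand, so progress is measured by
    the number of grid lines still to be crossed.\<close>
  proof (induction "nat (cells (X + t *\<^sub>R v) - cells X)" arbitrary: X t rule: less_induct)
    case less
    show ?case
    proof (cases "t < hit X")
      case True
      then show ?thesis using less.prems(1) by (intro exI[of _ 0] exI[of _ t]) auto
    next
      case False
      let ?t = "t - hit X"
      have eq: "nxt X + ?t *\<^sub>R v = X + t *\<^sub>R v"
        by (simp add: nxt_def algebra_simps)
      have t: "0 \<le> ?t" using False by simp
      have "cells (nxt X) = cells X + 1"
        using less.prems(2)[of 0] by (intro cells_nxt) simp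
      moreover have "cells (nxt X) \<le> cells (nxt X + ?t *\<^sub>R v)"
        using t by (rule cells_mono)
      ultimately have "nat (cells (nxt X + ?t *\<^sub>R v) - cells (nxt X)) < nat (cells (X + t *\<^sub>R v) - cells X)"
        unfolding eq by linarith
      moreover have "fold_pt ((nxt ^^ Suc k) (nxt X)) \<notin> corners" for k
        using less.prems(2)[of "Suc k"] by (simp add: funpow_swap1)
      ultimately obtain k t' where "nxt X + ?t *\<^sub>R v = (nxt ^^ k) (nxt X) + t' *\<^sub>R v"
          "0 \<le> t'" "t' < hit ((nxt ^^ k) (nxt X))"
        using less.hyps[of "nxt X" ?t] t by blast
      then show ?thesis unfolding eq
        by (intro exI[of _ "Suc k"] exI[of _ t']) (auto simp: funpow_swap1)
    qed
  qed
  then show ?thesis using that by blast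
qed

lemma traj_eq:
  assumes "\<And>k. fold_pt ((nxt ^^ Suc k) X) \<notin> corners"
  shows "traj X k = Some (fold_pt ((nxt ^^ k) X), heading ((nxt ^^ k) X))"
proof (induction k)
  case (Suc k)
  then show ?case using assms[of k] by (simp add: bounce_heading)
qed simp

lemma orbit_flow:
  assumes "\<And>k. fold_pt ((nxt ^^ Suc k) X) \<notin> corners"
  shows "orbit (traj X) = {fold_pt (X + t *\<^sub>R v) | t. 0 \<le> t}"
proof
  show "orbit (traj X) \<subseteq> {fold_pt (X + t *\<^sub>R v) | t. 0 \<le> t}"
  proof
    fix y assume "y \<in> orbit (traj X)"
    then obtain k where "y \<in> seg (fold_pt ((nxt ^^ k) X), heading ((nxt ^^ k) X))"
      unfolding orbit_def traj_eq[OF assms] by blast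
    then obtain t' where "0 \<le> t'" "y = fold_pt ((nxt ^^ k) X + t' *\<^sub>R v)"
      unfolding seg_heading by blast
    moreover obtain t where "(nxt ^^ k) X = X + t *\<^sub>R v" "0 \<le> t"
      by (rule iterate_flow)
    ultimately show "y \<in> {fold_pt (X + t *\<^sub>R v) | t. 0 \<le> t}"
      by (intro CollectI exI[of _ "t + t'"]) (auto simp: algebra_simps)
  qed
  show "{fold_pt (X + t *\<^sub>R v) | t. 0 \<le> t} \<subseteq> orbit (traj X)"
  proof
    fix y assume "y \<in> {fold_pt (X + t *\<^sub>R v) | t. 0 \<le> t}"
    then obtain t where t: "0 \<le> t" "y = fold_pt (X + t *\<^sub>R v)" by blast
    obtain k t' where "X + t *\<^sub>R v = (nxt ^^ k) X + t' *\<^sub>R v" "0 \<le> t'" "t' < hit ((nxt ^^ k) X)"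
      using flow_cell[OF t(1) assms] by blast
    then have "y \<in> seg (fold_pt ((nxt ^^ k) X), heading ((nxt ^^ k) X))"
      unfolding seg_heading t(2) by (metis (mono_tags, lifting) mem_Collect_eq less_imp_le)
    then show "y \<in> orbit (traj X)"
      unfolding orbit_def using traj_eq[OF assms, of k] by blast
  qed
qed

text \<open>The iterates describe the trajectory only as long as no corner has been met, so both
  facts advance together: a segment that exists as predicted has its end in the orbit, hence not in
  a corner, and so has a successor.\<close>

lemma nonsingular_iterate:
  assumes "\<not> singular (traj X)"
  shows "fold_pt ((nxt ^^ Suc k) X) \<notin> corners"
proof -
  have *: "fold_pt (nxt ((nxt ^^ k) X)) \<notin> corners"
    if "traj X k = Some (fold_pt ((nxt ^^ k) X), heading ((nxt ^^ k) X))" for k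
  proof -
    have "fold_pt (nxt ((nxt ^^ k) X)) \<in> seg (fold_pt ((nxt ^^ k) X), heading ((nxt ^^ k) X))"
      using hit_pos[of "(nxt ^^ k) X"] unfolding seg_heading nxt_def[of "(nxt ^^ k) X"]
      by (intro CollectI exI[of _ "hit ((nxt ^^ k) X)"]) simp
    then have "fold_pt (nxt ((nxt ^^ k) X)) \<in> orbit (traj X)"
      unfolding orbit_def using that by blast
    then show ?thesis using assms unfolding singular_def by blast
  qed
  have "traj X k = Some (fold_pt ((nxt ^^ k) X), heading ((nxt ^^ k) X))" for k
  proof (induction k)
    case (Suc k)
    then show ?case using *[OF Suc] by (simp add: bounce_heading)
  qed simp
  then show ?thesis using * by simp
qed

section \<open>Closing up and bounce points of the unfolded flow\<close>

text \<open>A return in the same direction is a displacement of the unfolded point by an even vector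
  \<open>(2 * i, 2 * j)\<close>, and the number of bounces is the number
  \<open>2 * i + 2 * j\<close> of grid lines crossed on the way.\<close>

lemma returns_after_iff:
  assumes nc: "\<And>k. fold_pt ((nxt ^^ Suc k) X) \<notin> corners"
  shows "returns_after (traj X) n \<longleftrightarrow>
    (\<exists>t (i::int) (j::int). 0 \<le> t \<and> t * fst v = 2 * of_int i \<and> t * snd v = 2 * of_int j \<and> int n = 2 * i + 2 * j)"
    (is "_ \<longleftrightarrow> ?R")
proof
  let ?Z = "(nxt ^^ n) X"
  assume "returns_after (traj X) n"
  then have "heading ?Z = heading X" "fold_pt X \<in> seg (fold_pt ?Z, heading ?Z)"
    unfolding returns_after_def using traj_eq[OF nc, of n] by auto
  then have d: "dir (fst ?Z) = dir (fst X)" "dir (snd ?Z) = dir (snd X)"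
    and s: "fold_pt X \<in> seg (fold_pt ?Z, heading ?Z)"
    using pos by (auto simp: heading_def)
  obtain t' where t': "fold_pt X = fold_pt (?Z + t' *\<^sub>R v)" "0 \<le> t'" "t' \<le> hit ?Z"
    using s unfolding seg_heading by blast
  have le: "0 \<le> t' * fst v" "0 \<le> t' * snd v" using t' pos by auto
  obtain i :: int where i: "fst ?Z + t' * fst v = fst X + 2 * of_int i" "\<lfloor>fst ?Z\<rfloor> = \<lfloor>fst X\<rfloor> + 2 * i"
    by (rule tent_return[of "fst ?Z" "fst ?Z + t' * fst v" "fst X"])
       (use le t' d in \<open>auto simp: le_hit_iff fold_pt_def\<close>)
  obtain j :: int where j: "snd ?Z + t' * snd v = snd X + 2 * of_int j" "\<lfloor>snd ?Z\<rfloor> = \<lfloor>snd X\<rfloor> + 2 * j"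
    by (rule tent_return[of "snd ?Z" "snd ?Z + t' * snd v" "snd X"])
       (use le t' d in \<open>auto simp: le_hit_iff fold_pt_def\<close>)
  have "int n = 2 * i + 2 * j"
    using i(2) j(2) cells_iterate[OF nc, of n] by (simp add: cells_def)
  moreover obtain t where t: "?Z = X + t *\<^sub>R v" "0 \<le> t" by (rule iterate_flow)
  have "(t + t') * fst v = 2 * of_int i" "(t + t') * snd v = 2 * of_int j"
    using i(1) j(1) unfolding t by (simp_all add: algebra_simps)
  ultimately show ?R using t(2) t'(2) by (intro exI[of _ "t + t'"] exI[of _ i] exI[of _ j]) simp
next
  assume ?R
  then obtain t and i j :: int
    where t: "0 \<le> t" "t * fst v = 2 * of_int i" "t * snd v = 2 * of_int j" "int n = 2 * i + 2 * j"
    by blast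
  obtain k t' where k: "X + t *\<^sub>R v = (nxt ^^ k) X + t' *\<^sub>R v" "0 \<le> t'" "t' < hit ((nxt ^^ k) X)"
    using flow_cell[OF t(1) nc] by blast
  let ?Z = "(nxt ^^ k) X"
  have xt: "fst (X + t *\<^sub>R v) = fst X + 2 * of_int i" "snd (X + t *\<^sub>R v) = snd X + 2 * of_int j"
    using t by auto
  have fl: "\<lfloor>fst ?Z\<rfloor> = \<lfloor>fst X + 2 * of_int i\<rfloor>" "\<lfloor>snd ?Z\<rfloor> = \<lfloor>snd X + 2 * of_int j\<rfloor>"
    using floor_flow[OF k(2,3)] unfolding k(1)[symmetric] xt by auto
  then have "\<lfloor>fst ?Z\<rfloor> = \<lfloor>fst X\<rfloor> + 2 * i" "\<lfloor>snd ?Z\<rfloor> = \<lfloor>snd X\<rfloor> + 2 * j"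
    by linarith+
  \<comment> \<open>The crossing counter identifies the segment that contains the return as the one
    after the \<open>n\<close>-th bounce.\<close>
  then have "k = n"
    using t(4) cells_iterate[OF nc, of k] by (simp add: cells_def)
  have "heading ?Z = heading X"
    using fl dir_add_even[of "fst X" i] dir_add_even[of "snd X" j]
    by (simp add: heading_def dir_def)
  moreover have "fold_pt X = fold_pt (X + t *\<^sub>R v)"
    unfolding fold_pt_def xt by simp
  then have "fold_pt X \<in> seg (fold_pt ?Z, heading ?Z)"
    using k unfolding seg_heading by (metis (mono_tags, lifting) mem_Collect_eq less_imp_le)
  ultimately show "returns_after (traj X) n"
    unfolding returns_after_def using traj_eq[OF nc, of n] \<open>k = n\<close> by simp
qed

text \<open>Positive times correspond to positive bounce numbers, so a start on a side counts only
  when it is passed again.\<close>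

lemma bounce_points_eq:
  assumes nc: "\<And>k. fold_pt ((nxt ^^ Suc k) X) \<notin> corners"
  shows "bounce_points (traj X) =
    {fold_pt (X + t *\<^sub>R v) | t. 0 < t \<and> (fst (X + t *\<^sub>R v) \<in> \<int> \<or> snd (X + t *\<^sub>R v) \<in> \<int>)}" (is "_ = ?B")
proof -
  have "bounce_points (traj X) = {fold_pt ((nxt ^^ k) X) | k. 0 < k}"
    unfolding bounce_points_def traj_eq[OF nc] by (auto simp del: funpow.simps) metis
  also have "\<dots> = ?B"
  proof
    show "{fold_pt ((nxt ^^ k) X) | k. 0 < k} \<subseteq> ?B"
    proof
      fix y assume "y \<in> {fold_pt ((nxt ^^ k) X) | k. 0 < k}"
      then obtain k where y: "y = fold_pt ((nxt ^^ k) X)" and "0 < k" by blast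
      from \<open>0 < k\<close> obtain l where l: "k = Suc l" by (cases k) auto
      let ?Y = "(nxt ^^ l) X"
      have le: "fst (nxt ?Y) \<le> of_int \<lfloor>fst ?Y\<rfloor> + 1" "snd (nxt ?Y) \<le> of_int \<lfloor>snd ?Y\<rfloor> + 1"
        using le_hit_iff[of "hit ?Y" ?Y] by (auto simp: nxt_def)
      have "\<not> (fst (nxt ?Y) < of_int \<lfloor>fst ?Y\<rfloor> + 1 \<and> snd (nxt ?Y) < of_int \<lfloor>snd ?Y\<rfloor> + 1)"
        using less_hit_iff[of "hit ?Y" ?Y] by (simp add: nxt_def)
      then have "fst (nxt ?Y) = of_int \<lfloor>fst ?Y\<rfloor> + 1 \<or> snd (nxt ?Y) = of_int \<lfloor>snd ?Y\<rfloor> + 1"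
        using le by linarith
      then have "fst ((nxt ^^ k) X) \<in> \<int> \<or> snd ((nxt ^^ k) X) \<in> \<int>"
        unfolding l by auto
      moreover obtain t where "(nxt ^^ k) X = X + t *\<^sub>R v" "0 < t"
        using iterate_flow \<open>0 < k\<close> by metis
      ultimately show "y \<in> ?B"
        unfolding y by (intro CollectI exI[of _ t]) simp
    qed
    show "?B \<subseteq> {fold_pt ((nxt ^^ k) X) | k. 0 < k}"
    proof
      fix y assume "y \<in> ?B"
      then obtain t where y: "y = fold_pt (X + t *\<^sub>R v)" and t: "0 < t"
        and int: "fst (X + t *\<^sub>R v) \<in> \<int> \<or> snd (X + t *\<^sub>R v) \<in> \<int>" by blast
      obtain k t' where k: "X + t *\<^sub>R v = (nxt ^^ k) X + t' *\<^sub>R v" "0 \<le> t'" "t' < hit ((nxt ^^ k) X)"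
        using flow_cell[OF less_imp_le[OF t] nc] by blast
      let ?Z = "(nxt ^^ k) X"
      \<comment> \<open>Moving forward from \<open>x\<close> without leaving its half-open cell, an
        integer can only be met at \<open>x\<close> itself; so a grid point of the ray is the start
        of its segment.\<close>
      have *: "w = 0" if "x + w \<in> \<int>" "\<lfloor>x + w\<rfloor> = \<lfloor>x\<rfloor>" "0 \<le> w" for x w :: real
      proof -
        from that(1) obtain n where n: "x + w = of_int n" by (elim Ints_cases)
        then have "\<lfloor>x\<rfloor> = n" using that(2) by simp
        then show ?thesis using n that(3) by linarith
      qed
      have "t' * fst v = 0 \<or> t' * snd v = 0"
        using int *[of "fst ?Z" "t' * fst v"] *[of "snd ?Z" "t' * snd v"] floor_flow[OF k(2,3)] k(2) pos
        unfolding k(1) by auto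
      then have "t' = 0" using pos by auto
      then have eq: "X + t *\<^sub>R v = ?Z" using k(1) by simp
      have "k \<noteq> 0"
        using eq t pos by (intro notI) (auto simp: prod_eq_iff)
      then show "y \<in> {fold_pt ((nxt ^^ k) X) | k. 0 < k}"
        unfolding y eq by blast
    qed
  qed
  finally show ?thesis .
qed

end

subsection \<open>The covering radius of a folded line\<close>

definition folded_line :: "nat \<Rightarrow> nat \<Rightarrow> real \<Rightarrow> point set" where
  "folded_line p q c = fold_pt ` {z. real p * fst z - real q * snd z = c}"

lemma coprime_bezout_int:
  assumes "coprime (p::nat) (q::nat)"
  obtains m n :: int where "int p * m - int q * n = k"
proof -
  have "coprime (int p) (int q)" using assms by simp
  moreover obtain x y where "x * int p + y * int q = gcd (int p) (int q)"
    using bezout_int by blast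
  ultimately have "int p * x + int q * y = 1"
    by (simp add: mult.commute)
  moreover have "int p * (x * k) - int q * (- y * k) = (int p * x + int q * y) * k"
    by (simp add: algebra_simps)
  ultimately show ?thesis using that[of "x * k" "- y * k"] by simp
qed

lemma fold_pt_add_even:
  "fold_pt (x + 2 * of_int i, y + 2 * of_int j) = fold_pt (x, y)"
  by (simp add: fold_pt_def)

text \<open>Bezout provides an even translation that shifts levels by \<open>2 * k\<close>, and the
  central symmetry negates them; folding is invariant under both.\<close>

lemma folded_line_cong:
  assumes "coprime p q" "tent c = tent d"
  shows "folded_line p q c = folded_line p q d"
proof -
  have *: "folded_line p q c \<subseteq> folded_line p q d" if "tent c = tent d" for c d
  proof
    fix y assume "y \<in> folded_line p q c"
    then obtain z where z: "y = fold_pt z" "real p * fst z - real q * snd z = c"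
      unfolding folded_line_def by blast
    obtain k :: int where k: "d = 2 * of_int k + c \<or> d = 2 * of_int k - c"
      using \<open>tent c = tent d\<close> tent_eq_iff[of d c] by metis
    obtain m n where "int p * m - int q * n = k" by (rule coprime_bezout_int[OF assms(1)])
    then have mn: "real p * of_int m - real q * of_int n = of_int k"
      by (metis of_int_diff of_int_mult of_int_of_nat_eq)
    show "y \<in> folded_line p q d"
      using k
    proof
      assume d: "d = 2 * of_int k + c"
      let ?z = "(fst z + 2 * of_int m, snd z + 2 * of_int n)"
      have "y = fold_pt ?z" by (simp add: z(1) fold_pt_add_even)
      moreover have "real p * fst ?z - real q * snd ?z = d"
        using z(2) mn d by (simp add: algebra_simps)
      ultimately show ?thesis unfolding folded_line_def by blast
    next
      assume d: "d = 2 * of_int k - c"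
      let ?z = "(- fst z + 2 * of_int m, - snd z + 2 * of_int n)"
      have "y = fold_pt ?z" unfolding z(1) fold_pt_add_even by (simp add: fold_pt_def)
      moreover have "real p * fst ?z - real q * snd ?z = d"
        using z(2) mn d by (simp add: algebra_simps)
      ultimately show ?thesis unfolding folded_line_def by blast
    qed
  qed
  show ?thesis using *[of c d] *[of d c] assms(2) by auto
qed

lemma tent_add_le: "tent (x + y) \<le> tent x + tent y"
proof -
  obtain k l :: int where "tent x = \<bar>x - 2 * of_int k\<bar>" "tent y = \<bar>y - 2 * of_int l\<bar>"
    by (metis tent_nearest)
  then show ?thesis using tent_le[of "x + y" "k + l"] by simp
qed

lemma tent_mult_nat_le: "tent (real n * x) \<le> real n * tent x"
proof (induction n)
  case (Suc n)
  then show ?case using tent_add_le[of "real n * x" x] by (simp add: algebra_simps)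
qed (simp add: tent_idem)

text \<open>This bounds from below the distance between the corner \<open>(0, 0)\<close> and any
  folded point of a given level; \<open>tent\<close> absorbs all ways of unfolding at once.\<close>

lemma tent_line_le:
  "tent (real p * x - real q * y) \<le> sqrt ((real p)\<^sup>2 + (real q)\<^sup>2) * norm (fold_pt (x, y))"
proof -
  have "tent (real p * x - real q * y) \<le> tent (real p * x) + tent (real q * y)"
    using tent_add_le[of "real p * x" "- (real q * y)"] by simp
  also have "\<dots> \<le> real p * tent x + real q * tent y"
    by (intro add_mono tent_mult_nat_le)
  also have "\<dots> = (real p, real q) \<bullet> fold_pt (x, y)"
    by (simp add: fold_pt_def)
  also have "\<dots> \<le> norm (real p, real q) * norm (fold_pt (x, y))"
    by (rule norm_cauchy_schwarz)
  finally show ?thesis by (simp add: norm_prod_def)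
qed

lemma tent_add_even_nat: "even m \<Longrightarrow> tent (x + of_int m) = tent x"
  by (elim evenE) simp

text \<open>Translation by \<open>(i, j)\<close> moves the corner \<open>(i, j)\<close> to the role
  of the origin and shifts the level by \<open>p * i - q * j\<close>. An even shift gives the bound
  \<open>tent c\<close>, an odd one \<open>1 - tent c\<close>; the corner is chosen to get the
  larger.\<close>

lemma far_corner:
  assumes "coprime p q" "0 < p" "0 < q"
  obtains z where "z \<in> table"
    "\<And>y. y \<in> folded_line p q c \<Longrightarrow> max (tent c) (1 - tent c) / sqrt ((real p)\<^sup>2 + (real q)\<^sup>2) \<le> dist y z"
proof -
  let ?S = "sqrt ((real p)\<^sup>2 + (real q)\<^sup>2)"
  have S: "0 < ?S" using assms by (simp add: add_pos_pos)
  have norm_eq: "norm (fold_pt (x + of_int i, y + of_int j)) = dist (fold_pt (x, y)) (of_int i, of_int j)"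
    if "i \<in> {0, 1}" "j \<in> {0, 1}" for x y and i j :: int
    using that by (auto simp: fold_pt_def norm_prod_def dist_prod_def tent_add_one dist_real_def power2_commute)
  have key: "tent (c + of_int (int p * i - int q * j)) \<le> ?S * dist w (of_int i, of_int j)"
    if ij: "i \<in> {0, 1}" "j \<in> {0, 1}" and w: "w \<in> folded_line p q c" for i j :: int and w
  proof -
    obtain x y where xy: "w = fold_pt (x, y)" "real p * x - real q * y = c"
      using w unfolding folded_line_def by auto
    have "c + of_int (int p * i - int q * j) = real p * (x + of_int i) - real q * (y + of_int j)"
      unfolding xy(2)[symmetric] by (simp add: algebra_simps)
    then show ?thesis
      using tent_line_le[of p "x + of_int i" q "y + of_int j"] norm_eq[OF ij, of x y] unfolding xy(1)
      by simp
  qed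
  show ?thesis
  proof (cases "1 - tent c \<le> tent c")
    case True
    show ?thesis
    proof (rule that[of "(0, 0)"])
      show "(0, 0) \<in> table" by (simp add: table_def)
      show "max (tent c) (1 - tent c) / ?S \<le> dist y (0, 0)" if "y \<in> folded_line p q c" for y
        using key[of 0 0 y] True S that by (simp add: pos_divide_le_eq mult.commute)
    qed
  next
    case False
    have odd: "tent (c + of_int k) = 1 - tent c" if "odd k" for k
      using tent_add_even_nat[of "k - 1" "c + 1"] that by (simp add: tent_add_one)
    \<comment> \<open>A corner adjacent to the origin thus produces an odd shift.\<close>
    have "odd p \<or> odd q" using assms(1) by (metis coprime_common_divisor odd_one)
    then show ?thesis
    proof
      assume "odd p"
      show ?thesis
      proof (rule that[of "(1, 0)"])
        show "(1, 0) \<in> table" by (simp add: table_def)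
        show "max (tent c) (1 - tent c) / ?S \<le> dist y (1, 0)" if "y \<in> folded_line p q c" for y
          using key[of 1 0 y] odd[of "int p"] \<open>odd p\<close> False S that by (simp add: pos_divide_le_eq mult.commute)
      qed
    next
      assume "odd q"
      show ?thesis
      proof (rule that[of "(0, 1)"])
        show "(0, 1) \<in> table" by (simp add: table_def)
        show "max (tent c) (1 - tent c) / ?S \<le> dist y (0, 1)" if "y \<in> folded_line p q c" for y
          using key[of 0 1 y] odd[of "- int q"] \<open>odd q\<close> False S that by (simp add: pos_divide_le_eq mult.commute)
      qed
    qed
  qed
qed

lemma folded_line_near:
  assumes "coprime p q" "0 < p" "0 < q" "z \<in> table"
  obtains w where "w \<in> folded_line p q c"
    "dist w z \<le> max (tent c) (1 - tent c) / sqrt ((real p)\<^sup>2 + (real q)\<^sup>2)"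
proof -
  let ?S = "sqrt ((real p)\<^sup>2 + (real q)\<^sup>2)"
  have S: "0 < ?S" "?S\<^sup>2 = (real p)\<^sup>2 + (real q)\<^sup>2" using assms by (simp_all add: add_pos_pos)
  define d where "d = real p * fst z - real q * snd z"
  obtain k where k: "d = 2 * of_int k + tent d \<or> d = 2 * of_int k - tent d"
    by (metis tent_cases)
  \<comment> \<open>The level equivalent to \<open>c\<close> that lies on the same side of
    \<open>2 * of_int k\<close> as \<open>d\<close>; the two levels then differ by just the
    difference of their \<open>tent\<close> values.\<close>
  define e where "e = (if d = 2 * of_int k + tent d then 2 * of_int k + tent c else 2 * of_int k - tent c)"
  have "\<bar>e - 2 * of_int k\<bar> = tent c" using tent_bounds[of c] by (auto simp: e_def)
  then have tent_e: "tent e = tent c" using tent_eqI[of e k] tent_bounds[of c] by simp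
  have "\<bar>d - e\<bar> = \<bar>tent d - tent c\<bar>" using k by (auto simp: e_def)
  also have "\<dots> \<le> max (tent c) (1 - tent c)" using tent_bounds[of d] by auto
  finally have de: "\<bar>d - e\<bar> \<le> max (tent c) (1 - tent c)" .
  \<comment> \<open>\<open>w\<close> is the orthogonal projection of \<open>z\<close> to the line of
    level \<open>e\<close>, whose normal is \<open>(p, - q)\<close>.\<close>
  define r where "r = (d - e) / ?S\<^sup>2"
  define w where "w = z - r *\<^sub>R (real p, - real q)"
  have "real p * fst w - real q * snd w = d - r * ?S\<^sup>2"
    unfolding S(2) by (simp add: w_def d_def algebra_simps power2_eq_square)
  also have "\<dots> = e" using S(1) assms(2) by (simp add: r_def)
  finally have "fold_pt w \<in> folded_line p q c"
    unfolding folded_line_cong[OF assms(1) tent_e[symmetric]] by (auto simp: folded_line_def)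
  \<comment> \<open>\<open>w\<close> may lie outside the table; folding brings it back and fixes
    \<open>z\<close>, without increasing the distance.\<close>
  moreover have "dist (fold_pt w) z \<le> dist w z"
    using dist_fold_pt[of w z] by (simp add: fold_pt_table[OF assms(4)])
  moreover have "dist w z = \<bar>r\<bar> * ?S"
  proof -
    have "dist w z = norm (r *\<^sub>R (real p, - real q))"
      unfolding w_def dist_norm by (simp add: norm_prod_def)
    also have "\<dots> = \<bar>r\<bar> * norm (real p, - real q)" by (rule norm_scaleR)
    finally show ?thesis by (simp add: norm_prod_def)
  qed
  moreover have "\<bar>r\<bar> * ?S = \<bar>d - e\<bar> / ?S"
  proof -
    have "\<bar>(d - e) / s\<^sup>2\<bar> * s = \<bar>d - e\<bar> / s" if "0 < s" for s
      using that by (simp add: power2_eq_square abs_divide)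
    then show ?thesis using S(1) unfolding r_def .
  qed
  moreover have "\<bar>d - e\<bar> / ?S \<le> max (tent c) (1 - tent c) / ?S"
    using de S(1) by (intro divide_right_mono) auto
  ultimately show ?thesis by (intro that[of "fold_pt w"]) auto
qed

text \<open>As neighbourhoods are open, the far corner excludes even \<open>r = ?R\<close>; the
  admissible radii form an open ray and the infimum is not attained.\<close>

lemma rcov_folded_line:
  assumes "coprime p q" "0 < p" "0 < q" "orbit \<gamma> = folded_line p q c"
  shows "rcov \<gamma> = max (tent c) (1 - tent c) / sqrt ((real p)\<^sup>2 + (real q)\<^sup>2)" (is "_ = ?R")
proof -
  have S: "0 < sqrt ((real p)\<^sup>2 + (real q)\<^sup>2)" using assms by (simp add: add_pos_pos)
  have R: "0 < ?R" using S by auto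
  have "{r. r > 0 \<and> table \<subseteq> nbhd r \<gamma>} = {?R<..}"
  proof (intro equalityI subsetI)
    fix r assume "r \<in> {r. r > 0 \<and> table \<subseteq> nbhd r \<gamma>}"
    moreover obtain z where "z \<in> table" "\<And>y. y \<in> folded_line p q c \<Longrightarrow> ?R \<le> dist y z"
      using far_corner[OF assms(1-3)] by metis
    ultimately show "r \<in> {?R<..}"
      unfolding nbhd_def assms(4) by (fastforce simp: ball_def)
  next
    fix r assume r: "r \<in> {?R<..}"
    have "z \<in> nbhd r \<gamma>" if z: "z \<in> table" for z
    proof -
      obtain w where "w \<in> folded_line p q c" "dist w z \<le> ?R"
        by (rule folded_line_near[OF assms(1-3) z])
      moreover from this(2) have "dist w z < r" using r by simp
      ultimately show ?thesis unfolding nbhd_def assms(4) by auto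
    qed
    then show "r \<in> {r. r > 0 \<and> table \<subseteq> nbhd r \<gamma>}" using r R by auto
  qed
  then show ?thesis by (simp add: rcov_def)
qed

subsection \<open>Bounce points of a closed trajectory\<close>

text \<open>The values have period \<open>p\<close> in \<open>m\<close>, so one block of
  \<open>p\<close> consecutive integers yields all of them. A coincidence inside the block is either
  a translation, making \<open>p\<close> divide \<open>m - n\<close>, or a reflection, making
  \<open>c\<close> an integer.\<close>

lemma card_tent_progression:
  fixes r :: real
  assumes "coprime p q" "0 < p" "c \<notin> \<int>"
  shows "card {tent ((c + 2 * of_int m * real q) / real p) | m :: int. r < of_int m} = p"
proof -
  define g where "g m = tent ((c + 2 * of_int m * real q) / real p)" for m :: int
  \<comment> \<open>The least integer above \<open>r\<close>, where the block starts.\<close>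
  define M where "M = \<lfloor>r\<rfloor> + 1"
  have period: "g (m + int p * k) = g m" for m k
  proof -
    have "(c + 2 * of_int (m + int p * k) * real q) / real p =
        (c + 2 * of_int m * real q) / real p + 2 * of_int (k * int q)"
      using assms(2) by (simp add: field_simps)
    then show ?thesis unfolding g_def by (simp only: tent_add_even)
  qed
  have "{tent ((c + 2 * of_int m * real q) / real p) | m :: int. r < of_int m} = g ` {M..<M + int p}"
  proof (intro equalityI subsetI)
    fix y assume "y \<in> {tent ((c + 2 * of_int m * real q) / real p) | m :: int. r < of_int m}"
    then obtain m where "y = g m" unfolding g_def by blast
    also have "\<dots> = g (M + (m - M) mod int p)"
      using period[of "M + (m - M) mod int p" "(m - M) div int p"]
      by (simp add: algebra_simps minus_div_mult_eq_mod[symmetric])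
    finally show "y \<in> g ` {M..<M + int p}" using assms(2) by auto
  next
    fix y assume "y \<in> g ` {M..<M + int p}"
    then obtain m where "M \<le> m" "y = g m" by auto
    moreover from this have "r < of_int m" unfolding M_def by linarith
    ultimately show "y \<in> {tent ((c + 2 * of_int m * real q) / real p) | m :: int. r < of_int m}"
      unfolding g_def by blast
  qed
  moreover have "inj_on g {M..<M + int p}"
  proof (rule inj_onI)
    fix m n assume mn: "m \<in> {M..<M + int p}" "n \<in> {M..<M + int p}" "g m = g n"
    then obtain k :: int where
      "(c + 2 * of_int m * real q) / real p = 2 * of_int k + (c + 2 * of_int n * real q) / real p \<or>
       (c + 2 * of_int m * real q) / real p = 2 * of_int k - (c + 2 * of_int n * real q) / real p"
      unfolding g_def tent_eq_iff by blast
    then show "m = n"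
    proof
      assume "(c + 2 * of_int m * real q) / real p = 2 * of_int k + (c + 2 * of_int n * real q) / real p"
      then have "of_int m * real q = of_int n * real q + of_int k * real p"
        using assms(2) by (simp add: field_simps)
      then have "real_of_int ((m - n) * int q) = real_of_int (k * int p)"
        by (simp add: algebra_simps)
      then have "(m - n) * int q = k * int p" by (simp only: of_int_eq_iff)
      then have "int p dvd (m - n) * int q" by simp
      then have "int p dvd m - n"
        using assms(1) by (simp add: coprime_dvd_mult_left_iff)
      moreover have "\<bar>m - n\<bar> < int p" using mn by auto
      ultimately show "m = n" using dvd_imp_le_int[of "m - n" "int p"] by fastforce
    next
      assume "(c + 2 * of_int m * real q) / real p = 2 * of_int k - (c + 2 * of_int n * real q) / real p"
      then have "c = of_int (k * int p - (m + n) * int q)"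
        using assms(2) by (simp add: field_simps)
      then show ?thesis using assms(3) by simp
    qed
  qed
  ultimately show ?thesis by (simp add: card_image)
qed

section \<open>Flows of rational slope\<close>

locale rational_flow = flow +
  fixes p q :: nat
  assumes coprime: "coprime p q" and pq_pos: "0 < p" "0 < q"
    and slope: "snd v * real q = fst v * real p"
begin

definition level :: "point \<Rightarrow> real" where
  "level z = real p * fst z - real q * snd z"

text \<open>\<open>v\<close> is \<open>speed\<close> times \<open>(q, p)\<close>, so in time
  \<open>2 / speed\<close> the flow moves by the even vector \<open>(2 * q, 2 * p)\<close>, which
  folding does not see.\<close>

definition speed :: real where
  "speed = fst v / real q"

lemma speed_pos: "0 < speed"
  using pos pq_pos by (simp add: speed_def)

lemma v_eq: "fst v = speed * real q" "snd v = speed * real p"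
  using slope pq_pos by (simp_all add: speed_def field_simps)

lemma level_flow [simp]: "level (X + t *\<^sub>R v) = level X"
proof -
  have "level (X + t *\<^sub>R v) = level X + t * (fst v * real p - snd v * real q)"
    by (simp add: level_def algebra_simps)
  then show ?thesis by (simp add: slope)
qed

lemma line_eq:
  assumes "level z = level X"
  obtains t where "z = X + t *\<^sub>R v"
proof -
  define t where "t = (fst z - fst X) / fst v"
  have 1: "fst z = fst X + t * fst v" using pos by (simp add: t_def)
  have "real q * (snd z - snd X) = real p * (fst z - fst X)"
    using assms by (simp add: level_def algebra_simps)
  also have "\<dots> = t * (snd v * real q)" by (simp add: 1 slope)
  finally have "real q * (snd z - snd X) = real q * (t * snd v)" by simp
  then have "snd z - snd X = t * snd v" using pq_pos by simp
  with 1 have "z = X + t *\<^sub>R v" by (simp add: prod_eq_iff)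
  then show ?thesis by (rule that)
qed

text \<open>A trajectory runs only along the forward half of its line. Adding enough closing times
  \<open>2 / speed\<close> brings any point of the line to nonnegative time without changing its
  folded image.\<close>

lemma forward_rep:
  assumes "level z = level X"
  obtains t where "0 \<le> t" "fold_pt z = fold_pt (X + t *\<^sub>R v)"
proof -
  obtain s where s: "z = X + s *\<^sub>R v" by (rule line_eq[OF assms])
  define m where "m = \<lceil>\<bar>s\<bar> * speed\<rceil>"
  define t where "t = s + 2 * of_int m / speed"
  have "\<bar>s\<bar> * speed \<le> of_int m" unfolding m_def by (rule le_of_int_ceiling)
  then have "\<bar>s\<bar> \<le> of_int m / speed" using speed_pos by (simp add: pos_le_divide_eq)
  then have "0 \<le> t" by (auto simp: t_def)
  moreover have "X + t *\<^sub>R v = (fst z + 2 * of_int (m * int q), snd z + 2 * of_int (m * int p))"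
    using speed_pos by (simp add: prod_eq_iff s t_def v_eq field_simps)
  then have "fold_pt z = fold_pt (X + t *\<^sub>R v)"
    by (simp only: fold_pt_add_even prod.collapse)
  ultimately show ?thesis by (rule that)
qed

lemma level_iterate [simp]: "level ((nxt ^^ k) X) = level X"
  by (rule iterate_flow[of k X]) simp

lemma level_corner: "fold_pt z \<in> corners \<Longrightarrow> level z \<in> \<int>"
  by (simp add: fold_pt_corner_iff level_def)

lemma iterate_noncorner: "level X \<notin> \<int> \<Longrightarrow> fold_pt ((nxt ^^ k) X) \<notin> corners"
  using level_corner[of "(nxt ^^ k) X"] by auto

lemma orbit_eq:
  assumes "\<And>k. fold_pt ((nxt ^^ Suc k) X) \<notin> corners"
  shows "orbit (traj X) = folded_line p q (level X)"
  unfolding orbit_flow[OF assms] folded_line_def level_def[symmetric]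
proof (intro equalityI subsetI)
  fix y assume "y \<in> {fold_pt (X + t *\<^sub>R v) | t. 0 \<le> t}"
  then show "y \<in> fold_pt ` {z. level z = level X}" by auto
next
  fix y assume "y \<in> fold_pt ` {z. level z = level X}"
  then show "y \<in> {fold_pt (X + t *\<^sub>R v) | t. 0 \<le> t}" using forward_rep by blast
qed

text \<open>Lattice points have integer level, and conversely Bezout puts a lattice point on every
  line of integer level.\<close>

lemma singular_iff: "singular (traj X) \<longleftrightarrow> level X \<in> \<int>"
proof
  assume *: "singular (traj X)"
  show "level X \<in> \<int>"
  proof (rule ccontr)
    assume "level X \<notin> \<int>"
    then have "orbit (traj X) = folded_line p q (level X)"
      by (intro orbit_eq iterate_noncorner)
    then obtain y where "y \<in> folded_line p q (level X)" "y \<in> corners"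
      using * unfolding singular_def by blast
    then obtain z where "fold_pt z \<in> corners" "level z = level X"
      unfolding folded_line_def level_def[symmetric] by blast
    then show False using level_corner \<open>level X \<notin> \<int>\<close> by metis
  qed
next
  assume "level X \<in> \<int>"
  then obtain k where k: "level X = of_int k" by (elim Ints_cases)
  obtain m n where "int p * m - int q * n = k" by (rule coprime_bezout_int[OF coprime])
  then have "real_of_int (int p * m - int q * n) = real_of_int k" by (simp only:)
  then have "level (of_int m, of_int n) = level X" unfolding k by (simp add: level_def)
  then have "fold_pt (of_int m, of_int n) \<in> folded_line p q (level X)"
    unfolding folded_line_def level_def by blast
  moreover have "fold_pt (of_int m, of_int n) \<in> corners" by (simp add: fold_pt_corner_iff)
  ultimately have "folded_line p q (level X) \<inter> corners \<noteq> {}" by blast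
  \<comment> \<open>Were the trajectory nonsingular, its orbit would be the whole folded line, which
    contains this corner.\<close>
  then show "singular (traj X)"
    using orbit_eq[of X] nonsingular_iterate[of X] unfolding singular_def by blast
qed

text \<open>A closing vector \<open>(2 * i, 2 * j)\<close> is parallel to \<open>(q, p)\<close>;
  coprimality makes \<open>(i, j)\<close> an integer multiple of \<open>(q, p)\<close>, so the
  crossing count is a multiple of \<open>2 * (p + q)\<close>.\<close>

lemma returns_after_iff_dvd:
  assumes "level X \<notin> \<int>"
  shows "returns_after (traj X) n \<longleftrightarrow> 2 * (p + q) dvd n"
proof -
  have "returns_after (traj X) n \<longleftrightarrow>
    (\<exists>t (i::int) (j::int). 0 \<le> t \<and> t * fst v = 2 * of_int i \<and> t * snd v = 2 * of_int j \<and> int n = 2 * i + 2 * j)"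
    (is "_ \<longleftrightarrow> ?R") by (intro returns_after_iff iterate_noncorner assms)
  also have "?R \<longleftrightarrow> 2 * (p + q) dvd n"
  proof
    assume ?R
    then obtain t and i j :: int where t: "t * fst v = 2 * of_int i" "t * snd v = 2 * of_int j"
      "int n = 2 * i + 2 * j" by blast
    have "t * (snd v * real q) = t * (fst v * real p)" by (simp add: slope)
    then have "real_of_int j * real q = real_of_int i * real p"
      using t by (simp add: mult.assoc[symmetric])
    then have "real_of_int (j * int q) = real_of_int (i * int p)" by simp
    then have eq: "j * int q = i * int p" by (simp only: of_int_eq_iff)
    then have "int q dvd i * int p" unfolding eq[symmetric] by simp
    then have "int q dvd i" using coprime by (simp add: coprime_dvd_mult_left_iff coprime_commute)
    then obtain m where i: "i = int q * m" by blast
    then have "j = int p * m" using eq pq_pos by simp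
    then have "int n = int (2 * (p + q)) * m" using t(3) i by (simp add: algebra_simps)
    then have "int (2 * (p + q)) dvd int n" by simp
    then show "2 * (p + q) dvd n" by (simp only: int_dvd_int_iff)
  next
    assume "2 * (p + q) dvd n"
    then obtain m where n: "n = 2 * (p + q) * m" by blast
    show ?R
      using speed_pos n
      by (intro exI[of _ "2 * real m / speed"] exI[of _ "int (q * m)"] exI[of _ "int (p * m)"])
         (simp add: v_eq algebra_simps)
  qed
  finally show ?thesis .
qed

lemma periodic_period:
  assumes "level X \<notin> \<int>"
  shows "periodic (traj X)" "period (traj X) = 2 * (p + q)"
proof -
  show "periodic (traj X)"
    unfolding periodic_def singular_iff returns_after_iff_dvd[OF assms]
    using assms pq_pos by (intro conjI exI[of _ "2 * (p + q)"]) simp_all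
  show "period (traj X) = 2 * (p + q)"
    unfolding period_def returns_after_iff_dvd[OF assms]
    using pq_pos by (intro Least_equality) (auto dest: dvd_imp_le)
qed

lemma fst_eq_level: "fst z = (level z + snd z * real q) / real p"
  using pq_pos by (simp add: level_def)

lemma snd_eq_level: "snd z = (- level z + fst z * real p) / real q"
  using pq_pos by (simp add: level_def)

text \<open>The bottom edge unfolds to the horizontal lines at even height \<open>2 * m\<close>. The
  formula is the abscissa at which the line of this level meets that height, and the bound on
  \<open>m\<close> expresses positive time.\<close>

lemma bounce_points_bottom:
  assumes "level X \<notin> \<int>"
  shows "bounce_points (traj X) \<inter> bottom_edge =
    (\<lambda>y. (y, 0)) ` {tent ((level X + 2 * of_int m * real q) / real p) | m :: int. snd X / 2 < of_int m}"
    (is "?A = ?B")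
proof -
  have bp: "bounce_points (traj X) =
    {fold_pt (X + t *\<^sub>R v) | t. 0 < t \<and> (fst (X + t *\<^sub>R v) \<in> \<int> \<or> snd (X + t *\<^sub>R v) \<in> \<int>)}"
    by (intro bounce_points_eq iterate_noncorner assms)
  show ?thesis
  proof (intro equalityI subsetI)
    fix y assume "y \<in> ?A"
    then have "snd y = 0" by (auto simp: bottom_edge_def)
    from \<open>y \<in> ?A\<close> obtain t where t: "0 < t" "y = fold_pt (X + t *\<^sub>R v)"
      unfolding bp by blast
    let ?z = "X + t *\<^sub>R v"
    have "tent (snd ?z) = 0" using \<open>snd y = 0\<close> t(2) by (simp add: fold_pt_def)
    then obtain m :: int where m: "snd ?z = 2 * of_int m" unfolding tent_eq_0_iff by blast
    have "snd X < snd ?z" using t(1) pos by simp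
    then have "snd X / 2 < of_int m" unfolding m by simp
    moreover have "fst ?z = (level X + 2 * of_int m * real q) / real p"
      using fst_eq_level[of ?z] unfolding level_flow m .
    ultimately have "tent (fst ?z) \<in> {tent ((level X + 2 * of_int m * real q) / real p) | m :: int. snd X / 2 < of_int m}"
      by (intro CollectI exI[of _ m]) simp
    moreover have "y = (tent (fst ?z), 0)"
      using \<open>tent (snd ?z) = 0\<close> by (simp add: t(2) fold_pt_def)
    ultimately show "y \<in> ?B" by simp
  next
    fix y assume "y \<in> ?B"
    then obtain m :: int where m: "snd X / 2 < of_int m"
      "y = (tent ((level X + 2 * of_int m * real q) / real p), 0)" by auto
    let ?z = "((level X + 2 * of_int m * real q) / real p, 2 * real_of_int m)"
    have "level ?z = level X" using pq_pos by (simp add: level_def)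
    then obtain t where t: "?z = X + t *\<^sub>R v" by (rule line_eq)
    then have "2 * of_int m = snd X + t * snd v" by (simp add: prod_eq_iff)
    then have "0 < t * snd v" using m(1) by simp
    then have "0 < t" using pos by (simp add: zero_less_mult_iff)
    moreover have z0: "tent (2 * of_int m) = 0" by (auto simp: tent_eq_0_iff)
    then have y: "y = fold_pt ?z" by (simp add: m(2) fold_pt_def)
    moreover have "snd ?z \<in> \<int>" by simp
    ultimately have "y \<in> bounce_points (traj X)"
      unfolding bp by (intro CollectI exI[of _ t]) (simp only: t[symmetric] simp_thms)
    moreover have "y \<in> bottom_edge"
      using fold_pt_in_table[of ?z] z0 unfolding y by (simp add: bottom_edge_def table_def fold_pt_def)
    ultimately show "y \<in> ?A" by blast
  qed
qed

lemma bounce_points_left: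
  assumes "level X \<notin> \<int>"
  shows "bounce_points (traj X) \<inter> left_edge =
    Pair 0 ` {tent ((- level X + 2 * of_int m * real p) / real q) | m :: int. fst X / 2 < of_int m}"
    (is "?A = ?B")
proof -
  have bp: "bounce_points (traj X) =
    {fold_pt (X + t *\<^sub>R v) | t. 0 < t \<and> (fst (X + t *\<^sub>R v) \<in> \<int> \<or> snd (X + t *\<^sub>R v) \<in> \<int>)}"
    by (intro bounce_points_eq iterate_noncorner assms)
  show ?thesis
  proof (intro equalityI subsetI)
    fix y assume "y \<in> ?A"
    then have "fst y = 0" by (auto simp: left_edge_def)
    from \<open>y \<in> ?A\<close> obtain t where t: "0 < t" "y = fold_pt (X + t *\<^sub>R v)"
      unfolding bp by blast
    let ?z = "X + t *\<^sub>R v"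
    have "tent (fst ?z) = 0" using \<open>fst y = 0\<close> t(2) by (simp add: fold_pt_def)
    then obtain m :: int where m: "fst ?z = 2 * of_int m" unfolding tent_eq_0_iff by blast
    have "fst X < fst ?z" using t(1) pos by simp
    then have "fst X / 2 < of_int m" unfolding m by simp
    moreover have "snd ?z = (- level X + 2 * of_int m * real p) / real q"
      using snd_eq_level[of ?z] unfolding level_flow m .
    ultimately have "tent (snd ?z) \<in> {tent ((- level X + 2 * of_int m * real p) / real q) | m :: int. fst X / 2 < of_int m}"
      by (intro CollectI exI[of _ m]) simp
    moreover have "y = (0, tent (snd ?z))"
      using \<open>tent (fst ?z) = 0\<close> by (simp add: t(2) fold_pt_def)
    ultimately show "y \<in> ?B" by simp
  next
    fix y assume "y \<in> ?B"
    then obtain m :: int where m: "fst X / 2 < of_int m"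
      "y = (0, tent ((- level X + 2 * of_int m * real p) / real q))" by auto
    let ?z = "(2 * real_of_int m, (- level X + 2 * of_int m * real p) / real q)"
    have "level ?z = level X" using pq_pos by (simp add: level_def)
    then obtain t where t: "?z = X + t *\<^sub>R v" by (rule line_eq)
    then have "2 * of_int m = fst X + t * fst v" by (simp add: prod_eq_iff)
    then have "0 < t * fst v" using m(1) by simp
    then have "0 < t" using pos by (simp add: zero_less_mult_iff)
    moreover have z0: "tent (2 * of_int m) = 0" by (auto simp: tent_eq_0_iff)
    then have y: "y = fold_pt ?z" by (simp add: m(2) fold_pt_def)
    moreover have "fst ?z \<in> \<int>" by simp
    ultimately have "y \<in> bounce_points (traj X)"
      unfolding bp by (intro CollectI exI[of _ t]) (simp only: t[symmetric] simp_thms)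
    moreover have "y \<in> left_edge"
      using fold_pt_in_table[of ?z] z0 unfolding y by (simp add: left_edge_def table_def fold_pt_def)
    ultimately show "y \<in> ?A" by blast
  qed
qed

lemma card_bounce_points:
  assumes "level X \<notin> \<int>"
  shows "card (bounce_points (traj X) \<inter> bottom_edge) = p"
    and "card (bounce_points (traj X) \<inter> left_edge) = q"
proof -
  show "card (bounce_points (traj X) \<inter> bottom_edge) = p"
    unfolding bounce_points_bottom[OF assms]
    by (subst card_image) (simp add: inj_on_def, rule card_tent_progression[OF coprime pq_pos(1) assms])
  have "- level X \<notin> \<int>" using assms by (metis Ints_minus minus_minus)
  moreover have "coprime q p" using coprime by (simp add: coprime_commute)
  ultimately show "card (bounce_points (traj X) \<inter> left_edge) = q"
    unfolding bounce_points_left[OF assms]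
    by (subst card_image) (simp add: inj_on_def, rule card_tent_progression[OF _ pq_pos(2)])
qed

end

text \<open>The closing displacement is a positive multiple of \<open>v\<close> and an even vector,
  so \<open>v\<close> has slope \<open>j / i\<close>; division by the gcd gives lowest
  terms.\<close>

lemma (in flow) periodic_imp_rational:
  assumes "periodic (traj X)"
  obtains p q where "rational_flow v p q"
proof -
  obtain n where n: "0 < n" "returns_after (traj X) n" and "\<not> singular (traj X)"
    using assms unfolding periodic_def by blast
  then obtain t and i j :: int where t: "0 \<le> t" "t * fst v = 2 * of_int i"
    "t * snd v = 2 * of_int j" "int n = 2 * i + 2 * j"
    using returns_after_iff[of X n] nonsingular_iterate by blast
  have "t \<noteq> 0" using t n(1) by auto
  then have "0 < t" using t(1) by simp
  then have "0 < t * fst v" "0 < t * snd v" using pos by auto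
  then have ij: "0 < i" "0 < j" unfolding t(2,3) by auto
  define g where "g = gcd i j"
  have "0 < g" unfolding g_def using ij by simp
  obtain a b where ab: "i = a * g" "j = b * g" "coprime a b"
    using gcd_coprime_exists[of i j] \<open>0 < g\<close> unfolding g_def by auto
  have ab_pos: "0 < a" "0 < b" using ij \<open>0 < g\<close> unfolding ab(1,2) by (auto simp: zero_less_mult_iff)
  have "t * (snd v * of_int a) * of_int g = (t * snd v) * of_int i" by (simp add: ab(1))
  also have "\<dots> = (t * fst v) * of_int j" unfolding t(2,3) by simp
  also have "\<dots> = t * (fst v * of_int b) * of_int g" by (simp add: ab(2))
  finally have "snd v * of_int a = fst v * of_int b" using \<open>0 < t\<close> \<open>0 < g\<close> by simp
  then have "rational_flow v (nat b) (nat a)"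
    using ab ab_pos by unfold_locales (simp_all add: coprime_commute coprime_int_iff[symmetric] del: coprime_int_iff)
  then show ?thesis by (rule that)
qed

subsection \<open>The class of trajectories\<close>

lemma exit_point_horizontal:
  assumes "x \<in> table" "norm u = 1" "snd u = 0"
  shows "fst (exit_point x u) \<in> {0, 1}" "snd (exit_point x u) = snd x"
proof -
  have x: "0 \<le> fst x" "fst x \<le> 1" "0 \<le> snd x" "snd x \<le> 1"
    using assms(1) by (auto simp: table_def)
  have "\<bar>fst u\<bar> = 1" using assms(2,3) by (simp add: norm_prod_def)
  then consider "fst u = 1" | "fst u = - 1" by linarith
  then show "fst (exit_point x u) \<in> {0, 1}"
  proof cases
    case 1
    then have "{t. x + t *\<^sub>R u \<in> table} = {- fst x..1 - fst x}"
      using x assms(3) by (auto simp: table_def mem_Times_iff)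
    then show ?thesis using 1 by (simp add: exit_point_def)
  next
    case 2
    then have "{t. x + t *\<^sub>R u \<in> table} = {fst x - 1..fst x}"
      using x assms(3) by (auto simp: table_def mem_Times_iff)
    then show ?thesis using 2 by (simp add: exit_point_def)
  qed
  show "snd (exit_point x u) = snd x" by (simp add: exit_point_def assms(3))
qed

lemma exit_point_vertical:
  assumes "x \<in> table" "norm u = 1" "fst u = 0"
  shows "snd (exit_point x u) \<in> {0, 1}" "fst (exit_point x u) = fst x"
proof -
  have x: "0 \<le> fst x" "fst x \<le> 1" "0 \<le> snd x" "snd x \<le> 1"
    using assms(1) by (auto simp: table_def)
  have "\<bar>snd u\<bar> = 1" using assms(2,3) by (simp add: norm_prod_def)
  then consider "snd u = 1" | "snd u = - 1" by linarith
  then show "snd (exit_point x u) \<in> {0, 1}"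
  proof cases
    case 1
    then have "{t. x + t *\<^sub>R u \<in> table} = {- snd x..1 - snd x}"
      using x assms(3) by (auto simp: table_def mem_Times_iff)
    then show ?thesis using 1 by (simp add: exit_point_def)
  next
    case 2
    then have "{t. x + t *\<^sub>R u \<in> table} = {snd x - 1..snd x}"
      using x assms(3) by (auto simp: table_def mem_Times_iff)
    then show ?thesis using 2 by (simp add: exit_point_def)
  qed
  show "fst (exit_point x u) = fst x" by (simp add: exit_point_def assms(3))
qed

lemma exit_point_in_orbit: "exit_point x u \<in> orbit (traj_from (x, u))"
proof -
  have "traj_from (x, u) 0 = Some (x, u)" by simp
  moreover have "exit_point x u \<in> seg (x, u)" by (simp add: seg_def)
  ultimately show ?thesis unfolding orbit_def by blast
qed

lemma horizontal_misses_bottom: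
  assumes "x \<in> table" "norm u = 1" "snd u = 0" "\<not> singular (traj_from (x, u))"
  shows "bounce_points (traj_from (x, u)) \<inter> bottom_edge = {}"
proof -
  have "exit_point x u \<notin> corners"
    using exit_point_in_orbit assms(4) unfolding singular_def by blast
  then have "snd x \<notin> {0, 1}"
    using exit_point_horizontal[OF assms(1-3)] unfolding corners_def mem_Times_iff by auto
  have "snd y = snd x \<and> snd w = 0" if "traj_from (x, u) k = Some (y, w)" for k y w
    using that
  proof (induction k arbitrary: y w)
    case 0
    then show ?case using assms(3) by simp
  next
    case (Suc k)
    then obtain y' w' where "traj_from (x, u) k = Some (y', w')" "bounce (y', w') = Some (y, w)"
      by (auto simp: bind_eq_Some_conv)
    then show ?case using Suc.IH[of y' w'] \<open>snd x \<notin> {0, 1}\<close>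
      by (auto simp: bounce_def Let_def exit_point_def reflect_def split: if_splits)
  qed
  then show ?thesis
    using \<open>snd x \<notin> {0, 1}\<close> unfolding bounce_points_def bottom_edge_def by fastforce
qed

lemma vertical_misses_left:
  assumes "x \<in> table" "norm u = 1" "fst u = 0" "\<not> singular (traj_from (x, u))"
  shows "bounce_points (traj_from (x, u)) \<inter> left_edge = {}"
proof -
  have "exit_point x u \<notin> corners"
    using exit_point_in_orbit assms(4) unfolding singular_def by blast
  then have "fst x \<notin> {0, 1}"
    using exit_point_vertical[OF assms(1-3)] unfolding corners_def mem_Times_iff by auto
  have "fst y = fst x \<and> fst w = 0" if "traj_from (x, u) k = Some (y, w)" for k y w
    using that
  proof (induction k arbitrary: y w)
    case 0
    then show ?case using assms(3) by simp
  next
    case (Suc k)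
    then obtain y' w' where "traj_from (x, u) k = Some (y', w')" "bounce (y', w') = Some (y, w)"
      by (auto simp: bind_eq_Some_conv)
    then show ?case using Suc.IH[of y' w'] \<open>fst x \<notin> {0, 1}\<close>
      by (auto simp: bounce_def Let_def exit_point_def reflect_def split: if_splits)
  qed
  then show ?thesis
    using \<open>fst x \<notin> {0, 1}\<close> unfolding bounce_points_def left_edge_def by fastforce
qed

section \<open>Lifting trajectories of the class to the unfolded flow\<close>

text \<open>A rising coordinate lifts to \<open>x\<close> in the cell from 0 to 1, a falling one to
  \<open>2 - x\<close> in the cell from 1 to 2. The time \<open>t\<close> ensures that the
  coordinate is not already at the wall towards which it moves.\<close>

lemma unfold_coordinate:
  assumes "0 \<le> x" "x \<le> 1" "u \<noteq> 0" "0 < t" "0 \<le> x + t * u" "x + t * u \<le> 1"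
  obtains X where "tent X = x" "dir X * \<bar>u\<bar> = u"
proof (cases "0 < u")
  case True
  then have "0 < t * u" using assms by simp
  then have "x < 1" using assms by linarith
  then have "\<lfloor>x\<rfloor> = 0" using assms by linarith
  then show ?thesis using True assms by (intro that[of x]) (auto simp: tent_idem dir_def)
next
  case False
  then have "t * u < 0" using assms by (simp add: mult_pos_neg)
  then have "0 < x" using assms by linarith
  then have "\<lfloor>2 - x\<rfloor> = 1" using assms by linarith
  moreover have "tent (2 - x) = x"
    using tent_add_even[of "- x" 1] assms by (simp add: tent_idem)
  ultimately show ?thesis using False assms by (intro that[of "2 - x"]) (auto simp: dir_def)
qed

lemma unfold_start:
  assumes "x \<in> table" "exit_point x u \<noteq> x" "fst u \<noteq> 0" "snd u \<noteq> 0"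
  obtains v X where "flow v" "fold_pt X = x" "flow.heading v X = u"
proof -
  have x: "0 \<le> fst x" "fst x \<le> 1" "0 \<le> snd x" "snd x \<le> 1"
    using assms(1) by (auto simp: table_def)
  \<comment> \<open>If no positive time stayed in the table, time 0 would be the maximum and the
    exit point would be \<open>x\<close>.\<close>
  have "\<exists>t>0. x + t *\<^sub>R u \<in> table"
  proof (rule ccontr)
    assume *: "\<not> (\<exists>t>0. x + t *\<^sub>R u \<in> table)"
    have "Sup {t. x + t *\<^sub>R u \<in> table} = 0"
      by (rule cSup_eq_maximum) (use * assms(1) in \<open>auto simp: not_less[symmetric]\<close>)
    then show False using assms(2) by (simp add: exit_point_def)
  qed
  then obtain t where t: "0 < t" "x + t *\<^sub>R u \<in> table" by blast
  then have r: "0 \<le> fst x + t * fst u" "fst x + t * fst u \<le> 1"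
    "0 \<le> snd x + t * snd u" "snd x + t * snd u \<le> 1"
    by (auto simp: table_def mem_Times_iff)
  obtain X1 where X1: "tent X1 = fst x" "dir X1 * \<bar>fst u\<bar> = fst u"
    by (rule unfold_coordinate[OF x(1,2) assms(3) t(1) r(1,2)])
  obtain X2 where X2: "tent X2 = snd x" "dir X2 * \<bar>snd u\<bar> = snd u"
    by (rule unfold_coordinate[OF x(3,4) assms(4) t(1) r(3,4)])
  let ?v = "(\<bar>fst u\<bar>, \<bar>snd u\<bar>)"
  have fl: "flow ?v" using assms(3,4) by unfold_locales auto
  show ?thesis
    by (rule that[of ?v "(X1, X2)"]) (use fl X1 X2 in \<open>simp_all add: fold_pt_def flow.heading_def\<close>)
qed

lemma traj_class_orbit:
  assumes "\<gamma> \<in> traj_class N p q" "0 < p" "0 < q"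
  obtains c where "c \<notin> \<int>" "orbit \<gamma> = folded_line p q c"
proof -
  have per: "periodic \<gamma>" and bot: "card (bounce_points \<gamma> \<inter> bottom_edge) = p"
    and left: "card (bounce_points \<gamma> \<inter> left_edge) = q" and "\<gamma> \<in> trajectories"
    using assms(1) by (auto simp: traj_class_def)
  then obtain x u where \<gamma>: "\<gamma> = traj_from (x, u)" and xu: "x \<in> table" "norm u = 1" "exit_point x u \<noteq> x"
    by (auto simp: trajectories_def)
  have ns: "\<not> singular (traj_from (x, u))" using per by (simp add: periodic_def \<gamma>)
  have "snd u \<noteq> 0"
    using horizontal_misses_bottom[OF xu(1,2) _ ns] bot assms(2) by (auto simp: \<gamma>)
  moreover have "fst u \<noteq> 0"
    using vertical_misses_left[OF xu(1,2) _ ns] left assms(3) by (auto simp: \<gamma>)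
  ultimately obtain v X where v: "flow v" "fold_pt X = x" "flow.heading v X = u"
    using unfold_start[OF xu(1,3)] by blast
  interpret flow v by (rule v(1))
  have \<gamma>': "\<gamma> = traj X" by (simp add: \<gamma> v)
  obtain p' q' where "rational_flow v p' q'"
    using periodic_imp_rational[of X] per unfolding \<gamma>' by blast
  then interpret r: rational_flow v p' q' .
  have lev: "r.level X \<notin> \<int>" using per r.singular_iff[of X] by (simp add: periodic_def \<gamma>')
  \<comment> \<open>Periodicity yields some slope in lowest terms; the bounce counts of the flow
    with that slope identify it.\<close>
  have "p' = p" "q' = q"
    using r.card_bounce_points[OF lev] bot left by (simp_all add: \<gamma>')
  moreover have "orbit \<gamma> = folded_line p' q' (r.level X)"
    unfolding \<gamma>' by (intro r.orbit_eq r.iterate_noncorner lev)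
  ultimately show ?thesis using that[OF lev] by simp
qed

text \<open>The direction is a positive multiple of \<open>(q, p)\<close> and the start already lies
  in the base cell, so it is its own lift, with level \<open>p * a\<close>.\<close>

lemma billiard_class:
  assumes "0 < a" "a < 1" "0 < p" "0 < q" "coprime p q"
  shows "billiard a (real p / real q) \<in> traj_class (2 * (p + q)) p q \<longleftrightarrow> real p * a \<notin> \<int>"
    and "real p * a \<notin> \<int> \<Longrightarrow> orbit (billiard a (real p / real q)) = folded_line p q (real p * a)"
proof -
  define m where "m = real p / real q"
  define u where "u = (cos (arctan m), sin (arctan m))"
  have m: "0 < m" using assms by (simp add: m_def)
  have cpos: "0 < cos (arctan m)" by (simp add: cos_arctan add_pos_nonneg)
  have sin: "sin (arctan m) = m * cos (arctan m)"
    using tan_arctan[of m] cpos by (simp add: tan_def field_simps)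
  interpret rational_flow u p q
  proof
    show "0 < fst u" using cpos by (simp add: u_def)
    show "0 < snd u" using cpos m by (simp add: u_def sin)
    have "snd u * real q = cos (arctan m) * (m * real q)" by (simp add: u_def sin)
    also have "m * real q = real p" using assms by (simp add: m_def)
    finally show "snd u * real q = fst u * real p" by (simp add: u_def)
  qed (use assms in auto)
  have fl: "fold_pt (a, 0) = (a, 0)" using assms by (intro fold_pt_table) (simp add: table_def)
  have "\<lfloor>a\<rfloor> = 0" using assms by linarith
  then have hd: "heading (a, 0) = u" by (simp add: heading_def dir_def)
  have b: "billiard a (real p / real q) = traj (a, 0)"
    by (simp add: billiard_def fl hd) (simp add: u_def m_def)
  have lev: "level (a, 0) = real p * a" by (simp add: level_def)
  have ex: "exit_point (a, 0) u \<noteq> (a, 0)"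
    using exit_point_heading[of "(a, 0)"] fold_pt_flow[of "hit (a, 0)" "(a, 0)"] hit_pos[of "(a, 0)"] pos
    by (auto simp: fl hd nxt_def prod_eq_iff)
  have "norm u = 1" by (simp add: u_def norm_prod_def)
  then have tr: "traj (a, 0) \<in> trajectories"
    using ex fold_pt_in_table[of "(a, 0)"] unfolding trajectories_def fl hd by blast
  show "billiard a (real p / real q) \<in> traj_class (2 * (p + q)) p q \<longleftrightarrow> real p * a \<notin> \<int>"
  proof
    assume "billiard a (real p / real q) \<in> traj_class (2 * (p + q)) p q"
    then show "real p * a \<notin> \<int>"
      using singular_iff[of "(a, 0)"] by (simp add: b traj_class_def periodic_def lev)
  next
    assume "real p * a \<notin> \<int>"
    then have "level (a, 0) \<notin> \<int>" by (simp add: lev)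
    then show "billiard a (real p / real q) \<in> traj_class (2 * (p + q)) p q"
      unfolding b traj_class_def using tr periodic_period[of "(a, 0)"] card_bounce_points[of "(a, 0)"] by simp
  qed
  show "orbit (billiard a (real p / real q)) = folded_line p q (real p * a)" if "real p * a \<notin> \<int>"
    unfolding b lev[symmetric] using that by (intro orbit_eq iterate_noncorner) (simp add: lev)
qed

text \<open>The parity of the cell only exchanges \<open>frac c\<close> and
  \<open>1 - frac c\<close>, which the maximum does not notice.\<close>

lemma max_tent: "max (tent c) (1 - tent c) = max (frac c) (1 - frac c)"
  by (auto simp: tent_def)

lemma half_le_max_tent: "1 / 2 \<le> max (tent c) (1 - tent c)"
  by (auto simp: max_def)

lemma max_tent_eq_half_iff: "max (tent c) (1 - tent c) = 1 / 2 \<longleftrightarrow> tent c = 1 / 2"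
  by (auto simp: max_def)

lemma tent_eq_half_iff: "tent c = 1 / 2 \<longleftrightarrow> (\<exists>k :: int. c = of_int k + 1 / 2)"
proof
  assume "tent c = 1 / 2"
  then have "frac c = 1 / 2" by (auto simp: tent_def split: if_splits)
  then have "c = of_int \<lfloor>c\<rfloor> + 1 / 2" by (simp add: frac_def)
  then show "\<exists>k :: int. c = of_int k + 1 / 2" by blast
next
  assume "\<exists>k :: int. c = of_int k + 1 / 2"
  then obtain k :: int where k: "c = of_int k + 1 / 2" by blast
  then have "\<lfloor>c\<rfloor> = k" by linarith
  then have "frac c = 1 / 2" using k by (simp add: frac_def)
  then show "tent c = 1 / 2" by (simp add: tent_def)
qed

theorem theorem3:
  fixes p q N :: nat
  assumes "p > 0" and "q > 0" and "coprime p q" and "N = 2 * (p + q)"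
  shows
    "(\<forall>a. 0 < a \<and> a < 1 \<and> billiard a (real p / real q) \<in> traj_class N p q \<longrightarrow>
        rcov (billiard a (real p / real q)) =
          1 / sqrt ((real p)\<^sup>2 + (real q)\<^sup>2) * max (frac (real p * a)) (1 - frac (real p * a))) \<and>
     (\<forall>a. 0 < a \<and> a < 1 \<longrightarrow>
        (is_arg_min rcov (\<lambda>\<gamma>. \<gamma> \<in> traj_class N p q) (billiard a (real p / real q)) \<longleftrightarrow>
         a \<in> {(2 * real i + 1) / (2 * real p) | i. i < p})) \<and>
     1 / (2 * sqrt ((real p)\<^sup>2 + (real q)\<^sup>2)) \<in> rcov ` traj_class N p q \<and>
     (\<forall>\<gamma>\<in>traj_class N p q. 1 / (2 * sqrt ((real p)\<^sup>2 + (real q)\<^sup>2)) \<le> rcov \<gamma>) \<and>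
     (\<forall>\<gamma>\<in>traj_class N p q.
        is_arg_min rcov (\<lambda>\<gamma>. \<gamma> \<in> traj_class N p q) \<gamma> \<longleftrightarrow>
        (\<exists>i<p. \<exists>a. (a, 0) = midpoint (real i / real p, 0) ((real i + 1) / real p, 0) \<and>
           orbit \<gamma> = orbit (billiard a (real p / real q))))"
proof -
  let ?S = "sqrt ((real p)\<^sup>2 + (real q)\<^sup>2)"
  let ?C = "traj_class N p q"
  let ?b = "\<lambda>a. billiard a (real p / real q)"
  have S: "0 < ?S" using assms by (simp add: add_pos_pos)
  note rcov = rcov_folded_line[OF assms(3,1,2)]
  have half: "1 / (2 * ?S) = 1 / 2 / ?S" by simp
  have b_class: "?b a \<in> ?C \<longleftrightarrow> real p * a \<notin> \<int>" if "0 < a" "a < 1" for a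
    using billiard_class(1)[OF that assms(1-3)] assms(4) by simp
  have b_orbit: "orbit (?b a) = folded_line p q (real p * a)" if "0 < a" "a < 1" "?b a \<in> ?C" for a
    using billiard_class(2)[OF that(1,2) assms(1-3)] b_class[OF that(1,2)] that(3) by simp
  have half_int: "c \<notin> \<int>" if "tent c = 1 / 2" for c
    using that tent_int_iff[of c] by auto
  have eq_iff: "rcov \<gamma> = 1 / (2 * ?S) \<longleftrightarrow> tent c = 1 / 2" if "orbit \<gamma> = folded_line p q c" for \<gamma> c
  proof -
    have "x / s = 1 / 2 / s \<longleftrightarrow> x = 1 / 2" if "0 < s" for x s :: real
      using that by (simp add: field_simps)
    note this[OF S]
    then show ?thesis unfolding rcov[OF that] half by (simp only: max_tent_eq_half_iff)
  qed
  have lower: "1 / (2 * ?S) \<le> rcov \<gamma>" if \<gamma>: "\<gamma> \<in> ?C" for \<gamma>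
  proof -
    obtain c where "orbit \<gamma> = folded_line p q c"
      by (rule traj_class_orbit[OF \<gamma> assms(1,2)])
    then show ?thesis unfolding half using S half_le_max_tent[of c]
      by (simp only: rcov) (intro divide_right_mono, auto)
  qed
  \<comment> \<open>The midpoint of the \<open>i\<close>-th subinterval is the start at which the
    level \<open>p * a\<close> equals \<open>i + 1 / 2\<close>.\<close>
  define mid where "mid i = (2 * real i + 1) / (2 * real p)" for i
  have mid: "0 < mid i" "mid i < 1" "tent (real p * mid i) = 1 / 2" if "i < p" for i
  proof -
    have "2 * real i + 1 < 2 * real p" using that by linarith
    then show "0 < mid i" "mid i < 1" using assms(1) by (simp_all add: mid_def)
    have "real p * mid i = of_int (int i) + 1 / 2" using assms(1) by (simp add: mid_def field_simps)
    then show "tent (real p * mid i) = 1 / 2" unfolding tent_eq_half_iff by blast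
  qed
  have mid_class: "?b (mid i) \<in> ?C" if "i < p" for i
    using b_class[OF mid(1,2)] half_int[OF mid(3)] that by simp
  have attained: "rcov (?b (mid i)) = 1 / (2 * ?S)" if "i < p" for i
    using eq_iff[OF b_orbit[OF mid(1,2) mid_class]] mid(3) that by simp
  \<comment> \<open>The lower bound is attained in the class, for instance with
    \<open>i = 0\<close>, so minimality amounts to equality with it.\<close>
  have arg_min: "is_arg_min rcov (\<lambda>\<gamma>. \<gamma> \<in> ?C) \<gamma> \<longleftrightarrow> \<gamma> \<in> ?C \<and> rcov \<gamma> = 1 / (2 * ?S)" for \<gamma>
    unfolding is_arg_min_def
    using lower attained[OF assms(1)] mid_class[OF assms(1)] by (metis linorder_not_less order_le_less)
  have "rcov (?b a) = 1 / ?S * max (frac (real p * a)) (1 - frac (real p * a))"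
    if "0 < a" "a < 1" "?b a \<in> ?C" for a
    using rcov[OF b_orbit[OF that]] by (simp add: max_tent)
  moreover have "is_arg_min rcov (\<lambda>\<gamma>. \<gamma> \<in> ?C) (?b a) \<longleftrightarrow> a \<in> {(2 * real i + 1) / (2 * real p) | i. i < p}"
    if a: "0 < a" "a < 1" for a
  proof
    assume "is_arg_min rcov (\<lambda>\<gamma>. \<gamma> \<in> ?C) (?b a)"
    then have "tent (real p * a) = 1 / 2"
      unfolding arg_min using eq_iff b_orbit[OF a] by blast
    then obtain k :: int where k: "real p * a = of_int k + 1 / 2" unfolding tent_eq_half_iff by blast
    have "0 < real p * a" "real p * a < real p" using a assms(1) by auto
    then have "0 \<le> k" "k < int p" unfolding k by linarith+
    moreover have "a = (2 * of_int k + 1) / (2 * real p)"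
      using k assms(1) by (simp add: field_simps)
    ultimately show "a \<in> {(2 * real i + 1) / (2 * real p) | i. i < p}"
      by (intro CollectI exI[of _ "nat k"]) auto
  next
    assume "a \<in> {(2 * real i + 1) / (2 * real p) | i. i < p}"
    then obtain i where "i < p" "a = mid i" unfolding mid_def by blast
    then show "is_arg_min rcov (\<lambda>\<gamma>. \<gamma> \<in> ?C) (?b a)"
      using mid_class attained by (simp add: arg_min)
  qed
  moreover have "1 / (2 * ?S) \<in> rcov ` ?C"
    using attained[OF assms(1)] mid_class[OF assms(1)] by (metis image_eqI)
  moreover have "is_arg_min rcov (\<lambda>\<gamma>. \<gamma> \<in> ?C) \<gamma> \<longleftrightarrow>
        (\<exists>i<p. \<exists>a. (a, 0) = midpoint (real i / real p, 0) ((real i + 1) / real p, 0) \<and>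
           orbit \<gamma> = orbit (?b a))" if \<gamma>: "\<gamma> \<in> ?C" for \<gamma>
  proof -
    have midp: "(a, 0) = midpoint (real i / real p, 0) ((real i + 1) / real p, 0) \<longleftrightarrow> a = mid i"
      for a :: real and i
      using assms(1) by (simp add: midpoint_def mid_def field_simps)
    obtain c where c: "orbit \<gamma> = folded_line p q c"
      by (rule traj_class_orbit[OF \<gamma> assms(1,2)])
    have "rcov \<gamma> = 1 / (2 * ?S) \<longleftrightarrow> (\<exists>i<p. orbit \<gamma> = orbit (?b (mid i)))"
    proof
      assume "rcov \<gamma> = 1 / (2 * ?S)"
      \<comment> \<open>The value \<open>1 / 2\<close> of \<open>tent\<close> determines the folded
        line, so all minimisers share one orbit and \<open>i = 0\<close> is a sufficient
        witness.\<close>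
      then have "tent c = tent (real p * mid 0)" using eq_iff[OF c] mid(3)[OF assms(1)] by simp
      then have "orbit \<gamma> = orbit (?b (mid 0))"
        unfolding c b_orbit[OF mid(1,2)[OF assms(1)] mid_class[OF assms(1)]]
        by (rule folded_line_cong[OF assms(3)])
      then show "\<exists>i<p. orbit \<gamma> = orbit (?b (mid i))" using assms(1) by blast
    next
      assume "\<exists>i<p. orbit \<gamma> = orbit (?b (mid i))"
      then obtain i where i: "i < p" "orbit \<gamma> = orbit (?b (mid i))" by blast
      then have "rcov \<gamma> = rcov (?b (mid i))" by (simp add: rcov_def nbhd_def)
      then show "rcov \<gamma> = 1 / (2 * ?S)" using attained[OF i(1)] by simp
    qed
    then show ?thesis unfolding arg_min midp using \<gamma> by simp
  qed
  ultimately show ?thesis using lower by blast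
qed

end
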